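(* Let $n\ge2$ and let $\mathbb{F}_q$ be a finite field with $\mathrm{char}(\mathbb{F}_q)\nmid 2n$. Let $G_A,G_B\subseteq D_{2n}$ be two proper subgroups of the dihedral group $D_{2n}$ of order $2n$ such that $G_{AB}:=G_A\cap G_B$ is abelian and normal in both $G_A$ and $G_B$, and such that $[G_A:G_{AB}]\cdot[G_B:G_{AB}]\cdot|G_{AB}|=2n$. Let $A\in\mathrm{Mat}_{m_A}(\mathbb{F}_q[G_A])$, $B\in\mathrm{Mat}_{m_B}(\mathbb{F}_q[G_B])$, and define $$d_0:=\min\{d(\mathcal{C}(A)),\,d(\mathcal{C}(B)),\,d(\mathcal{C}(A^\top)),\,d(\mathcal{C}(B^\top))\}.$$ Then the minimum distance $D$ of the lifted product code $LP(A,B)$ (where $A$ and $B$ are regarded as matrices over $\mathbb{F}_q[D_{2n}]$) satisfies $$D\ge\left\lfloor\frac{d_0}{|G_{AB}|}\right\rfloor.$$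
   Context: **Notation.** $\mathbb{F}_q[G]$ is the group algebra of a finite group $G$; for a subgroup $H\le G$, $\mathbb{F}_q[H]\subseteq\mathbb{F}_q[G]$. $\mathrm{Mat}_m$ denotes $m\times m$ matrices. $|c|$ denotes Hamming weight over $\mathbb{F}_q$. **Regular representations.** For $a\in\mathbb{F}_q[G]$, $L(a)$ and $R(a)$ are the $|G|\times|G|$ matrices over $\mathbb{F}_q$, in the basis $G$ of $\mathbb{F}_q[G]$, of the maps $x\mapsto ax$ and $x\mapsto xa$. For matrices $A=(a_{ij})$, $B=(b_{ij})$ over $\mathbb{F}_q[G]$ put ${}^\natural A=[L(a_{ij})^\top]_{i,j}$ and $B^\natural=[R(b_{ij})]_{i,j}$, block matrices over $\mathbb{F}_q$. **Classical codes.** $\mathcal{C}(H)=\ker H$ is the classical linear code over $\mathbb{F}_q$ with parity check matrix $H$, and $d(\cdot)$ is its minimum Hamming distance, i.e. the minimum Hamming weight of a nonzero codeword over $\mathbb{F}_q$ ($\infty$ for the zero code). For the matrices $A,B$ over group algebras, $\mathcal{C}(A),\mathcal{C}(A^\top),\mathcal{C}(B),\mathcal{C}(B^\top)$ are the codes over $\mathbb{F}_q$ with parity check matrices ${}^\natural A,({}^\natural A)^\top,B^\natural,(B^\natural)^\top$ respectively (computed with the regular representation of $G_A$, resp. $G_B$; using $D_{2n}$ instead gives a direct sum of copies of the same code, hence the same minimum distance). **Lifted product code.** For $A\in\mathrm{Mat}_{m_A\times n_A}(\mathbb{F}_q[G])$, $B\in\mathrm{Mat}_{m_B\times n_B}(\mathbb{F}_q[G])$,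 define, with Kronecker products and identity matrices taken over the ring $\mathbb{F}_q^{|G|\times|G|}$ (and $\top$ the transpose as matrices over $\mathbb{F}_q$), $$H_X^\natural=[{}^\natural A\otimes I_{m_B},\,-I_{m_A}\otimes B^\natural],\qquad H_Z^\natural=[I_{n_A}\otimes(B^\natural)^\top,\,({}^\natural A)^\top\otimes I_{n_B}].$$ $LP(A,B)$ is the quantum CSS code with parity check matrices $H_X^\natural,H_Z^\natural$; here $G=D_{2n}$, $n_A=m_A$, $n_B=m_B$. With $\mathcal{C}_X=\ker H_X^\natural$ and $\mathcal{C}_Z=\ker H_Z^\natural$, its minimum distance is $D=\min\{D_X,D_Z\}$, where $D_Z=\min_{c\in\mathcal{C}_Z\setminus\mathcal{C}_X^\perp}|c|$ and $D_X=\min_{c\in\mathcal{C}_X\setminus\mathcal{C}_Z^\perp}|c|$, with the convention that a minimum over the empty set is $\infty$. *)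

theory Defs
  imports
    "Jordan_Normal_Form.Matrix"
    "HOL-Algebra.Coset"
    "HOL-Library.Extended_Nat"
begin

section \<open>The dihedral group\<close>

text \<open>The pair \<open>(i, b)\<close> stands for \<open>r\<^sup>i s\<^sup>b\<close>, where \<open>r\<^sup>n = s\<^sup>2 = 1\<close> and \<open>s r = r\<^sup>-\<^sup>1 s\<close>.\<close>

definition dihedral :: "nat \<Rightarrow> (int \<times> bool) monoid" where
  "dihedral n =
     \<lparr>carrier = {0..<int n} \<times> UNIV,
      mult = (\<lambda>(i, a) (j, b). ((if a then i - j else i + j) mod int n, a \<noteq> b)),
      one = (0, False)\<rparr>"

lemma group_dihedral:
  assumes "n \<ge> 1"
  shows "group (dihedral n)"
proof (rule groupI)
  fix x assume "x \<in> carrier (dihedral n)"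
  then obtain i b where x: "x = (i, b)" "0 \<le> i" "i < int n"
    by (auto simp: dihedral_def)
  show "\<exists>y\<in>carrier (dihedral n). y \<otimes>\<^bsub>dihedral n\<^esub> x = \<one>\<^bsub>dihedral n\<^esub>"
    using assms x
    by (intro bexI[of _ "(if b then i else (- i) mod int n, b)"])
       (auto simp: dihedral_def mod_simps)
qed (use assms in \<open>auto simp: dihedral_def mod_simps algebra_simps\<close>)

lemma order_dihedral: "order (dihedral n) = 2 * n"
  by (simp add: order_def dihedral_def card_cartesian_product)

section \<open>Group algebras and regular representations\<close>

text \<open>An element \<open>\<Sum>g. a\<^sub>g g\<close> of the group algebra is its coefficient function.  With coefficient
  functions on the whole type, the group algebra of a subgroup is literally a subset of that of
  the group.\<close>

definition group_algebra :: "'g set \<Rightarrow> ('g \<Rightarrow> 'f::field) set" where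
  "group_algebra S = {a. \<forall>g. g \<notin> S \<longrightarrow> a g = 0}"

definition ga_mult :: "('g, 'b) monoid_scheme \<Rightarrow> ('g \<Rightarrow> 'f::field) \<Rightarrow> ('g \<Rightarrow> 'f) \<Rightarrow> 'g \<Rightarrow> 'f" where
  "ga_mult G a b = (\<lambda>g. \<Sum>(h, k) \<in> {(h, k) \<in> carrier G \<times> carrier G. h \<otimes>\<^bsub>G\<^esub> k = g}. a h * b k)"

definition ga_basis :: "'g \<Rightarrow> 'g \<Rightarrow> 'f::field" where
  "ga_basis h = (\<lambda>g. if g = h then 1 else 0)"

text \<open>A matrix is a function of a row index and a column index; its finite sets of row and column
  indices are carried along separately.  Column \<open>h\<close> of the matrix of a map holds the coefficients
  of the image of the basis element \<open>h\<close>.\<close>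

definition left_reg :: "('g, 'b) monoid_scheme \<Rightarrow> ('g \<Rightarrow> 'f::field) \<Rightarrow> 'g \<Rightarrow> 'g \<Rightarrow> 'f" where
  "left_reg G a = (\<lambda>g h. ga_mult G a (ga_basis h) g)"

definition right_reg :: "('g, 'b) monoid_scheme \<Rightarrow> ('g \<Rightarrow> 'f::field) \<Rightarrow> 'g \<Rightarrow> 'g \<Rightarrow> 'f" where
  "right_reg G a = (\<lambda>g h. ga_mult G (ga_basis h) a g)"

definition mtx_transpose :: "('r \<Rightarrow> 'c \<Rightarrow> 'f) \<Rightarrow> 'c \<Rightarrow> 'r \<Rightarrow> 'f" where
  "mtx_transpose M = (\<lambda>c r. M r c)"

text \<open>In a block matrix, the index \<open>(i, g)\<close> is position \<open>g\<close> inside block \<open>i\<close>.\<close>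

definition left_nat ::
  "('g, 'b) monoid_scheme \<Rightarrow> ('g \<Rightarrow> 'f::field) mat \<Rightarrow> nat \<times> 'g \<Rightarrow> nat \<times> 'g \<Rightarrow> 'f" where
  "left_nat G A = (\<lambda>(i, g) (j, h). mtx_transpose (left_reg G (A $$ (i, j))) g h)"

definition right_nat ::
  "('g, 'b) monoid_scheme \<Rightarrow> ('g \<Rightarrow> 'f::field) mat \<Rightarrow> nat \<times> 'g \<Rightarrow> nat \<times> 'g \<Rightarrow> 'f" where
  "right_nat G B = (\<lambda>(i, g) (j, h). right_reg G (B $$ (i, j)) g h)"

definition block_rows :: "('g, 'b) monoid_scheme \<Rightarrow> ('g \<Rightarrow> 'f) mat \<Rightarrow> (nat \<times> 'g) set" where
  "block_rows G A = {..<dim_row A} \<times> carrier G"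

definition block_cols :: "('g, 'b) monoid_scheme \<Rightarrow> ('g \<Rightarrow> 'f) mat \<Rightarrow> (nat \<times> 'g) set" where
  "block_cols G A = {..<dim_col A} \<times> carrier G"

section \<open>Linear codes\<close>

text \<open>Words over the finite coordinate set \<open>C\<close> are functions vanishing outside \<open>C\<close>.\<close>

definition ker_code :: "'r set \<Rightarrow> 'c set \<Rightarrow> ('r \<Rightarrow> 'c \<Rightarrow> 'f::field) \<Rightarrow> ('c \<Rightarrow> 'f) set" where
  "ker_code R C H =
     {x. (\<forall>c. c \<notin> C \<longrightarrow> x c = 0) \<and> (\<forall>r\<in>R. (\<Sum>c\<in>C. H r c * x c) = 0)}"

definition dual_code :: "'c set \<Rightarrow> ('c \<Rightarrow> 'f::field) set \<Rightarrow> ('c \<Rightarrow> 'f) set" where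
  "dual_code C K =
     {x. (\<forall>c. c \<notin> C \<longrightarrow> x c = 0) \<and> (\<forall>y\<in>K. (\<Sum>c\<in>C. x c * y c) = 0)}"

definition hamming_weight :: "('c \<Rightarrow> 'f::field) \<Rightarrow> nat" where
  "hamming_weight x = card {c. x c \<noteq> 0}"

text \<open>The infimum in \<^typ>\<open>enat\<close> is attained on a nonempty set and is \<open>\<infinity>\<close> on the empty set.\<close>

definition min_weight :: "('c \<Rightarrow> 'f::field) set \<Rightarrow> enat" where
  "min_weight K = (INF x\<in>K. enat (hamming_weight x))"

definition min_distance :: "('c \<Rightarrow> 'f::field) set \<Rightarrow> enat" where
  "min_distance K = min_weight (K - {\<lambda>_. 0})"

definition css_distance :: "'c set \<Rightarrow> ('c \<Rightarrow> 'f::field) set \<Rightarrow> ('c \<Rightarrow> 'f) set \<Rightarrow> enat" where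
  "css_distance C CX CZ =
     min (min_weight (CX - dual_code C CZ)) (min_weight (CZ - dual_code C CX))"

section \<open>Codes of a matrix over a group algebra\<close>

definition left_code ::
  "('g, 'b) monoid_scheme \<Rightarrow> ('g \<Rightarrow> 'f::field) mat \<Rightarrow> (nat \<times> 'g \<Rightarrow> 'f) set" where
  "left_code G A = ker_code (block_rows G A) (block_cols G A) (left_nat G A)"

definition left_code_transp ::
  "('g, 'b) monoid_scheme \<Rightarrow> ('g \<Rightarrow> 'f::field) mat \<Rightarrow> (nat \<times> 'g \<Rightarrow> 'f) set" where
  "left_code_transp G A = ker_code (block_cols G A) (block_rows G A) (mtx_transpose (left_nat G A))"

definition right_code ::
  "('g, 'b) monoid_scheme \<Rightarrow> ('g \<Rightarrow> 'f::field) mat \<Rightarrow> (nat \<times> 'g \<Rightarrow> 'f) set" where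
  "right_code G B = ker_code (block_rows G B) (block_cols G B) (right_nat G B)"

definition right_code_transp ::
  "('g, 'b) monoid_scheme \<Rightarrow> ('g \<Rightarrow> 'f::field) mat \<Rightarrow> (nat \<times> 'g \<Rightarrow> 'f) set" where
  "right_code_transp G B = ker_code (block_cols G B) (block_rows G B) (mtx_transpose (right_nat G B))"

section \<open>Lifted product codes\<close>

text \<open>The Kronecker product over the ring of matrices indexed by \<open>S \<times> S\<close>: the block at position
  \<open>((i, k), (j, l))\<close> is the product of the blocks \<open>M\<^sub>i\<^sub>j\<close> and \<open>N\<^sub>k\<^sub>l\<close>.  The identity matrix over that
  ring is the identity matrix over the field; its size is fixed by the index sets used below.\<close>

definition block_kron ::
  "'g set \<Rightarrow> ('i \<times> 'g \<Rightarrow> 'j \<times> 'g \<Rightarrow> 'f::field) \<Rightarrow> ('k \<times> 'g \<Rightarrow> 'l \<times> 'g \<Rightarrow> 'f)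
     \<Rightarrow> ('i \<times> 'k) \<times> 'g \<Rightarrow> ('j \<times> 'l) \<times> 'g \<Rightarrow> 'f" where
  "block_kron S M N =
     (\<lambda>((i, k), g) ((j, l), h). \<Sum>u\<in>S. M (i, g) (j, u) * N (k, u) (l, h))"

definition id_matrix :: "'r \<Rightarrow> 'r \<Rightarrow> 'f::field" where
  "id_matrix = (\<lambda>r c. if r = c then 1 else 0)"

definition neg_matrix :: "('r \<Rightarrow> 'c \<Rightarrow> 'f::field) \<Rightarrow> 'r \<Rightarrow> 'c \<Rightarrow> 'f" where
  "neg_matrix M = (\<lambda>r c. - M r c)"

definition hcat :: "('r \<Rightarrow> 'c \<Rightarrow> 'f) \<Rightarrow> ('r \<Rightarrow> 'd \<Rightarrow> 'f) \<Rightarrow> 'r \<Rightarrow> 'c + 'd \<Rightarrow> 'f" where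
  "hcat M N = (\<lambda>r. case_sum (M r) (N r))"

type_synonym 'g lp_check = "(nat \<times> nat) \<times> 'g"
type_synonym 'g lp_qudit = "((nat \<times> nat) \<times> 'g) + ((nat \<times> nat) \<times> 'g)"

definition lp_HX ::
  "('g, 'b) monoid_scheme \<Rightarrow> ('g \<Rightarrow> 'f::field) mat \<Rightarrow> ('g \<Rightarrow> 'f) mat
     \<Rightarrow> 'g lp_check \<Rightarrow> 'g lp_qudit \<Rightarrow> 'f" where
  "lp_HX G A B =
     hcat (block_kron (carrier G) (left_nat G A) id_matrix)
          (block_kron (carrier G) (neg_matrix id_matrix) (right_nat G B))"

definition lp_HZ ::
  "('g, 'b) monoid_scheme \<Rightarrow> ('g \<Rightarrow> 'f::field) mat \<Rightarrow> ('g \<Rightarrow> 'f) mat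
     \<Rightarrow> 'g lp_check \<Rightarrow> 'g lp_qudit \<Rightarrow> 'f" where
  "lp_HZ G A B =
     hcat (block_kron (carrier G) id_matrix (mtx_transpose (right_nat G B)))
          (block_kron (carrier G) (mtx_transpose (left_nat G A)) id_matrix)"

definition lp_X_checks ::
  "('g, 'b) monoid_scheme \<Rightarrow> ('g \<Rightarrow> 'f) mat \<Rightarrow> ('g \<Rightarrow> 'f) mat \<Rightarrow> 'g lp_check set" where
  "lp_X_checks G A B = ({..<dim_row A} \<times> {..<dim_row B}) \<times> carrier G"

definition lp_Z_checks ::
  "('g, 'b) monoid_scheme \<Rightarrow> ('g \<Rightarrow> 'f) mat \<Rightarrow> ('g \<Rightarrow> 'f) mat \<Rightarrow> 'g lp_check set" where
  "lp_Z_checks G A B = ({..<dim_col A} \<times> {..<dim_col B}) \<times> carrier G"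

definition lp_qudits ::
  "('g, 'b) monoid_scheme \<Rightarrow> ('g \<Rightarrow> 'f) mat \<Rightarrow> ('g \<Rightarrow> 'f) mat \<Rightarrow> 'g lp_qudit set" where
  "lp_qudits G A B =
     (({..<dim_col A} \<times> {..<dim_row B}) \<times> carrier G)
       <+> (({..<dim_row A} \<times> {..<dim_col B}) \<times> carrier G)"

definition lp_CX ::
  "('g, 'b) monoid_scheme \<Rightarrow> ('g \<Rightarrow> 'f::field) mat \<Rightarrow> ('g \<Rightarrow> 'f) mat \<Rightarrow> ('g lp_qudit \<Rightarrow> 'f) set"
  where "lp_CX G A B = ker_code (lp_X_checks G A B) (lp_qudits G A B) (lp_HX G A B)"

definition lp_CZ ::
  "('g, 'b) monoid_scheme \<Rightarrow> ('g \<Rightarrow> 'f::field) mat \<Rightarrow> ('g \<Rightarrow> 'f) mat \<Rightarrow> ('g lp_qudit \<Rightarrow> 'f) set"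
  where "lp_CZ G A B = ker_code (lp_Z_checks G A B) (lp_qudits G A B) (lp_HZ G A B)"

definition lp_distance ::
  "('g, 'b) monoid_scheme \<Rightarrow> ('g \<Rightarrow> 'f::field) mat \<Rightarrow> ('g \<Rightarrow> 'f) mat \<Rightarrow> enat" where
  "lp_distance G A B = css_distance (lp_qudits G A B) (lp_CX G A B) (lp_CZ G A B)"

text \<open>The floor of \<open>d / k\<close> for \<open>k > 0\<close>, with \<open>\<infinity> / k = \<infinity>\<close>.\<close>

definition enat_floor_div :: "enat \<Rightarrow> nat \<Rightarrow> enat" where
  "enat_floor_div d k = (case d of enat m \<Rightarrow> enat (m div k) | \<infinity> \<Rightarrow> \<infinity>)"

end

theory Submission
  imports Defs "HOL-Library.Function_Algebras"
begin

text \<open>The cardinality condition says \<open>G = P Q\<close> with \<open>P = G\<^sub>A\<close>, \<open>Q = G\<^sub>B\<close>, and \<open>A\<close>, \<open>B\<close> act by convolution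
  from the left over \<open>P\<close> and from the right over \<open>Q\<close>.  Let \<open>(u, v)\<close> satisfy \<open>A u = B v\<close> and have
  weight \<open>t < d\<^sub>0 / |P \<inter> Q|\<close>.  Saturating the support of \<open>u\<close> under right translation by \<open>Q\<close> gives a set \<open>S\<close>
  that meets the coordinates in \<open>P\<close> in at most \<open>t |P \<inter> Q| < d\<^sub>0\<close> places, so \<open>A\<close> is injective on words
  supported in \<open>S\<close>; likewise for \<open>B\<close> and the saturation \<open>T\<close> of the support of \<open>v\<close> under left translation by \<open>P\<close>.
  As \<open>|Q|\<close> is invertible, Maschke's averaging yields a left inverse \<open>D\<close> of \<open>A\<close> on \<open>S\<close> that commutes with
  right convolutions over \<open>Q\<close>.  Then \<open>w = D v\<close> satisfies \<open>B w = D B v = D A u = u\<close>, and \<open>A w - v\<close> is supported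
  in \<open>T\<close> and killed by \<open>B\<close>, so \<open>A w = v\<close>: the word is a combination of rows of the other check matrix.\<close>

section \<open>Linear algebra over finite index sets\<close>

lemma kernel_trivial_by_translation:
  fixes H :: "'r \<Rightarrow> 'c \<Rightarrow> 'f::field"
  assumes "finite C"
    and inj: "\<And>t. t \<in> T \<Longrightarrow> inj_on (\<phi> t) C\<^sub>0"
    and sub: "\<And>t. t \<in> T \<Longrightarrow> \<phi> t ` C\<^sub>0 \<subseteq> C"
    and cover: "C \<subseteq> (\<Union>t\<in>T. \<phi> t ` C\<^sub>0)"
    and rows: "\<And>t. t \<in> T \<Longrightarrow> \<psi> t ` R\<^sub>0 \<subseteq> R"
    and equiv: "\<And>t r c. t \<in> T \<Longrightarrow> r \<in> R\<^sub>0 \<Longrightarrow> c \<in> C\<^sub>0 \<Longrightarrow> H (\<psi> t r) (\<phi> t c) = H r c"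
    and diag: "\<And>t r c. t \<in> T \<Longrightarrow> r \<in> R\<^sub>0 \<Longrightarrow> c \<in> C - \<phi> t ` C\<^sub>0 \<Longrightarrow> H (\<psi> t r) c = 0"
    and sat: "\<And>t c. t \<in> T \<Longrightarrow> c \<in> C\<^sub>0 \<Longrightarrow> \<phi> t c \<in> S \<Longrightarrow> c \<in> S"
    and base: "\<And>y. y \<in> ker_code R\<^sub>0 C\<^sub>0 H \<Longrightarrow> {c. y c \<noteq> 0} \<subseteq> S \<Longrightarrow> y = (\<lambda>_. 0)"
    and x: "x \<in> ker_code R C H" "{c. x c \<noteq> 0} \<subseteq> S"
  shows "x = (\<lambda>_. 0)"
proof -
  have restrict: "x (\<phi> t c) = 0" if t: "t \<in> T" and c: "c \<in> C\<^sub>0" for t c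
  proof -
    define y where "y = (\<lambda>c. if c \<in> C\<^sub>0 then x (\<phi> t c) else 0)"
    have "y \<in> ker_code R\<^sub>0 C\<^sub>0 H"
    proof -
      have "(\<Sum>c\<in>C\<^sub>0. H r c * y c) = 0" if r: "r \<in> R\<^sub>0" for r
      proof -
        have "(\<Sum>c\<in>C\<^sub>0. H r c * y c) = (\<Sum>c\<in>C\<^sub>0. H (\<psi> t r) (\<phi> t c) * x (\<phi> t c))"
          by (rule sum.cong) (auto simp: y_def equiv t r)
        also have "\<dots> = (\<Sum>c\<in>\<phi> t ` C\<^sub>0. H (\<psi> t r) c * x c)"
          by (simp add: sum.reindex[OF inj[OF t]])
        also have "\<dots> = (\<Sum>c\<in>C. H (\<psi> t r) c * x c)"
          using sub[OF t] diag[OF t r] by (intro sum.mono_neutral_left \<open>finite C\<close>) auto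
        also have "\<dots> = 0"
          using x(1) rows[OF t] r by (auto simp: ker_code_def)
        finally show ?thesis .
      qed
      then show ?thesis by (auto simp: ker_code_def y_def)
    qed
    moreover have "{c. y c \<noteq> 0} \<subseteq> S"
      using x(2) sat[OF t] by (auto simp: y_def split: if_splits)
    ultimately have "y = (\<lambda>_. 0)" by (rule base)
    then show ?thesis using c by (metis y_def)
  qed
  show ?thesis
  proof
    fix c
    show "x c = 0"
    proof (cases "c \<in> C")
      case True
      then show ?thesis using cover restrict by blast
    next
      case False
      then show ?thesis using x(1) by (auto simp: ker_code_def)
    qed
  qed
qed

text \<open>A trivial kernel on \<open>S\<close> means that \<open>H\<close> is injective on the
  subspace of words supported in \<open>S\<close>, so it has a linear left inverse there;
  \<open>K\<close> is the matrix of that inverse.\<close>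

lemma left_inverse_kernel:
  fixes H :: "'r \<Rightarrow> 'c \<Rightarrow> 'f::field"
  assumes R: "finite R" and C: "finite C" and "S \<subseteq> C"
    and triv: "\<And>x. x \<in> ker_code R C H \<Longrightarrow> {c. x c \<noteq> 0} \<subseteq> S \<Longrightarrow> x = (\<lambda>_. 0)"
  obtains K :: "'c \<Rightarrow> 'r \<Rightarrow> 'f" where
    "\<And>x c. {c. x c \<noteq> 0} \<subseteq> S \<Longrightarrow> (\<Sum>r\<in>R. K c r * (\<Sum>c'\<in>C. H r c' * x c')) = x c"
proof -
  define sC where "sC = (\<lambda>(a::'f) (f::'c \<Rightarrow> 'f) x. a * f x)"
  define sR where "sR = (\<lambda>(a::'f) (f::'r \<Rightarrow> 'f) x. a * f x)"
  interpret VC: vector_space sC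
    by unfold_locales (auto simp: sC_def fun_eq_iff algebra_simps)
  interpret VR: vector_space sR
    by unfold_locales (auto simp: sR_def fun_eq_iff algebra_simps)
  interpret VP: vector_space_pair sC sR ..
  \<comment> \<open>Images are cut off outside \<open>R\<close>, which makes each of them a finite
    combination of unit vectors even when the index type is infinite.\<close>
  define f where "f = (\<lambda>x r. if r \<in> R then \<Sum>c\<in>C. H r c * x c else 0)"
  define V where "V = {x :: 'c \<Rightarrow> 'f. {c. x c \<noteq> 0} \<subseteq> S}"
  have f: "Vector_Spaces.linear sC sR f"
    by unfold_locales
      (auto simp: f_def sC_def sR_def fun_eq_iff sum.distrib sum_distrib_left algebra_simps)
  have V: "VC.subspace V"
    by (rule VC.subspaceI) (force simp: V_def sC_def)+
  have "inj_on f V"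
  proof (subst VP.linear_inj_on_iff_eq_0[OF f V], intro ballI impI)
    fix x assume x: "x \<in> V" "f x = 0"
    have "(\<Sum>c\<in>C. H r c * x c) = 0" if "r \<in> R" for r
      using fun_cong[OF x(2), of r] that by (simp add: f_def)
    moreover have "x c = 0" if "c \<notin> C" for c
      using x(1) that \<open>S \<subseteq> C\<close> by (auto simp: V_def)
    ultimately have "x = (\<lambda>_. 0)"
      using x(1) by (intro triv) (auto simp: V_def ker_code_def)
    then show "x = 0" by (simp add: fun_eq_iff)
  qed
  from VP.linear_exists_left_inverse_on[OF f V this] obtain g
    where g: "Vector_Spaces.linear sR sC g" and gf: "\<And>x. x \<in> V \<Longrightarrow> g (f x) = x" by blast
  interpret g: Vector_Spaces.linear sR sC g by (rule g)
  define e where "e = (\<lambda>(r::'r) r'. if r' = r then 1 else (0::'f))"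
  \<comment> \<open>The columns of the matrix \<open>K\<close> are the images under \<open>g\<close>
    of the unit vectors \<open>e r\<close>.\<close>
  have expand: "g y c = (\<Sum>r\<in>R. g (e r) c * y r)" if "\<And>r. r \<notin> R \<Longrightarrow> y r = 0" for y c
  proof -
    have fs: "(\<Sum>i\<in>X. F i) z = (\<Sum>i\<in>X. F i z)" for F :: "'r \<Rightarrow> 'z \<Rightarrow> 'f" and X z
      by (induction X rule: infinite_finite_induct) auto
    have "y = (\<Sum>r\<in>R. sR (y r) (e r))"
      using R that by (auto simp: fun_eq_iff fs sR_def e_def if_distrib cong: if_cong)
    then have "g y = g (\<Sum>r\<in>R. sR (y r) (e r))" by simp
    also have "\<dots> = (\<Sum>r\<in>R. sC (y r) (g (e r)))" by (simp add: g.sum g.scale)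
    finally show ?thesis by (simp add: fs sC_def mult.commute)
  qed
  show ?thesis
  proof
    fix x :: "'c \<Rightarrow> 'f" and c assume x: "{c. x c \<noteq> 0} \<subseteq> S"
    have "x c = g (f x) c" using gf x by (simp add: V_def)
    also have "\<dots> = (\<Sum>r\<in>R. g (e r) c * f x r)" by (rule expand) (simp add: f_def)
    also have "\<dots> = (\<Sum>r\<in>R. g (e r) c * (\<Sum>c'\<in>C. H r c' * x c'))"
      by (rule sum.cong) (auto simp: f_def)
    finally show "(\<Sum>r\<in>R. g (e r) c * (\<Sum>c'\<in>C. H r c' * x c')) = x c" ..
  qed
qed

text \<open>Every row is orthogonal to the kernel, hence so is every combination of rows. Only this
  easy inclusion of the row space in the dual is involved.\<close>

lemma row_combination_in_dual_code:
  assumes "finite C" and "\<And>c. c \<notin> C \<Longrightarrow> x c = 0"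
    and "\<And>c. c \<in> C \<Longrightarrow> x c = (\<Sum>r\<in>R. H r c * w r)"
  shows "x \<in> dual_code C (ker_code R C H)"
proof -
  have "(\<Sum>c\<in>C. x c * y c) = 0" if y: "y \<in> ker_code R C H" for y
  proof -
    have "(\<Sum>c\<in>C. x c * y c) = (\<Sum>c\<in>C. \<Sum>r\<in>R. w r * (H r c * y c))"
      using assms(3) by (intro sum.cong) (auto simp: sum_distrib_left sum_distrib_right algebra_simps)
    also have "\<dots> = (\<Sum>r\<in>R. w r * (\<Sum>c\<in>C. H r c * y c))"
      by (subst sum.swap) (simp add: sum_distrib_left)
    also have "\<dots> = 0" using y by (simp add: ker_code_def)
    finally show ?thesis .
  qed
  then show ?thesis using assms(2) by (simp add: dual_code_def)
qed

section \<open>A group factorised as a product of two subgroups\<close>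

text \<open>The set is the intersection of \<open>P\<close> with the left coset \<open>g Q\<close>.
  It is empty or a left coset of \<open>P \<inter> Q\<close>, as division by one of its elements
  shows.\<close>

lemma (in group) card_coset_section_le:
  assumes "subgroup P G" "subgroup Q G" "finite (carrier G)" "g \<in> carrier G"
  shows "card {p \<in> P. inv p \<otimes> g \<in> Q} \<le> card (P \<inter> Q)"
proof (cases "{p \<in> P. inv p \<otimes> g \<in> Q} = {}")
  case False
  interpret P: subgroup P G by fact
  interpret Q: subgroup Q G by fact
  from False obtain p\<^sub>0 where p0: "p\<^sub>0 \<in> P" "inv p\<^sub>0 \<otimes> g \<in> Q" by auto
  show ?thesis
  proof (rule card_inj_on_le)
    show "inj_on (\<lambda>p. inv p\<^sub>0 \<otimes> p) {p \<in> P. inv p \<otimes> g \<in> Q}"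
      using p0 by (auto intro!: inj_onI)
    have "inv p\<^sub>0 \<otimes> p \<in> Q" if "p \<in> P" "inv p \<otimes> g \<in> Q" for p
    proof -
      have "inv p\<^sub>0 \<otimes> p = (inv p\<^sub>0 \<otimes> g) \<otimes> inv (inv p \<otimes> g)"
        using that p0 assms(4)
        by (simp add: inv_mult_group m_assoc flip: m_assoc[of g])
      then show ?thesis using that p0 by simp
    qed
    then show "(\<lambda>p. inv p\<^sub>0 \<otimes> p) ` {p \<in> P. inv p \<otimes> g \<in> Q} \<subseteq> P \<inter> Q"
      using p0 by auto
    show "finite (P \<inter> Q)" using assms(3) P.subset finite_subset by blast
  qed
next
  case True
  then show ?thesis by (metis card.empty le0)
qed

text \<open>Multiplication maps the |P| |Q| pairs onto \<open>P <#> Q\<close> with fibres of size at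
  most |P \<inter> Q|, so \<open>P <#> Q\<close> has at least |G| elements.\<close>

lemma (in group) set_mult_eq_carrier:
  assumes "subgroup P G" "subgroup Q G" and fin: "finite (carrier G)"
    and card: "card P * card Q = order G * card (P \<inter> Q)"
  shows "P <#> Q = carrier G"
proof (rule card_seteq)
  interpret P: subgroup P G by fact
  interpret Q: subgroup Q G by fact
  have sub: "P <#> Q \<subseteq> carrier G" by (auto simp: set_mult_def)
  have finP: "finite P" "finite Q" using P.subset Q.subset fin finite_subset by blast+
  have finPQ: "finite (P <#> Q)" using sub fin finite_subset by blast
  have "P \<times> Q = (\<Union>g\<in>P <#> Q. {(p, q) \<in> P \<times> Q. p \<otimes> q = g})"
    by (auto simp: set_mult_def)
  from arg_cong[OF this, of card]
  have "card P * card Q = card (\<Union>g\<in>P <#> Q. {(p, q) \<in> P \<times> Q. p \<otimes> q = g})"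
    unfolding card_cartesian_product .
  also have "\<dots> \<le> (\<Sum>g\<in>P <#> Q. card {(p, q) \<in> P \<times> Q. p \<otimes> q = g})"
    by (rule card_UN_le[OF finPQ])
  also have "\<dots> \<le> (\<Sum>g\<in>P <#> Q. card (P \<inter> Q))"
  proof (rule sum_mono)
    fix g assume "g \<in> P <#> Q"
    then have g: "g \<in> carrier G" using sub by auto
    \<comment> \<open>In the fibre over \<open>g\<close> the first component determines the pair,
      since q must be \<open>inv p \<otimes> g\<close>.\<close>
    have "card {(p, q) \<in> P \<times> Q. p \<otimes> q = g} \<le> card {p \<in> P. inv p \<otimes> g \<in> Q}"
    proof (rule card_inj_on_le)
      show "inj_on fst {(p, q) \<in> P \<times> Q. p \<otimes> q = g}"
        by (auto simp: inj_on_def)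
      show "fst ` {(p, q) \<in> P \<times> Q. p \<otimes> q = g} \<subseteq> {p \<in> P. inv p \<otimes> g \<in> Q}"
        by (auto simp flip: m_assoc)
      show "finite {p \<in> P. inv p \<otimes> g \<in> Q}" using finP by simp
    qed
    also have "\<dots> \<le> card (P \<inter> Q)" by (rule card_coset_section_le) (use assms g in auto)
    finally show "card {(p, q) \<in> P \<times> Q. p \<otimes> q = g} \<le> card (P \<inter> Q)" .
  qed
  finally have "order G * card (P \<inter> Q) \<le> card (P <#> Q) * card (P \<inter> Q)"
    by (simp add: card)
  moreover have "card (P \<inter> Q) > 0"
    using finP P.one_closed Q.one_closed by (subst card_gt_0_iff) blast
  ultimately show "card (carrier G) \<le> card (P <#> Q)" by (simp add: order_def)
  show "P <#> Q \<subseteq> carrier G" by (rule sub)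
qed (rule fin)

section \<open>Factorised groups and convolution matrices over the two factors\<close>

locale factorised_group = group +
  fixes P Q :: "'a set"
  assumes finite_carrier: "finite (carrier G)"
    and subgroup_P: "subgroup P G" and subgroup_Q: "subgroup Q G"
    and factorisation: "P <#> Q = carrier G"
begin

sublocale P: subgroup P G by (rule subgroup_P)
sublocale Q: subgroup Q G by (rule subgroup_Q)

text \<open>The shape of \<open>left_nat G A\<close> for entries of \<open>A\<close> in the group
  algebra of \<open>P\<close>: a matrix entry depends only on \<open>h \<otimes> inv g\<close> and
  vanishes off \<open>P\<close>. Put as invariance plus support, the condition is stable under
  transposition, so one argument can serve both check matrices. \<open>right_conv\<close> is the
  mirror image for \<open>Q\<close>.\<close>

definition left_conv :: "'i set \<Rightarrow> 'j set \<Rightarrow> ('i \<times> 'a \<Rightarrow> 'j \<times> 'a \<Rightarrow> 'f::field) \<Rightarrow> bool" where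
  "left_conv I J M \<longleftrightarrow> (\<forall>i\<in>I. \<forall>j\<in>J. \<forall>g\<in>carrier G. \<forall>h\<in>carrier G.
     (\<forall>x\<in>carrier G. M (i, g \<otimes> x) (j, h \<otimes> x) = M (i, g) (j, h)) \<and>
     (M (i, g) (j, h) \<noteq> 0 \<longrightarrow> h \<otimes> inv g \<in> P))"

definition right_conv :: "'i set \<Rightarrow> 'j set \<Rightarrow> ('i \<times> 'a \<Rightarrow> 'j \<times> 'a \<Rightarrow> 'f::field) \<Rightarrow> bool" where
  "right_conv I J M \<longleftrightarrow> (\<forall>i\<in>I. \<forall>j\<in>J. \<forall>g\<in>carrier G. \<forall>h\<in>carrier G.
     (\<forall>x\<in>carrier G. M (i, x \<otimes> g) (j, x \<otimes> h) = M (i, g) (j, h)) \<and>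
     (M (i, g) (j, h) \<noteq> 0 \<longrightarrow> inv h \<otimes> g \<in> Q))"

lemma left_conv_translate:
  "left_conv I J M \<Longrightarrow> i \<in> I \<Longrightarrow> j \<in> J \<Longrightarrow> g \<in> carrier G \<Longrightarrow> h \<in> carrier G \<Longrightarrow>
    x \<in> carrier G \<Longrightarrow> M (i, g \<otimes> x) (j, h \<otimes> x) = M (i, g) (j, h)"
  unfolding left_conv_def by blast

lemma left_conv_eq_0:
  "left_conv I J M \<Longrightarrow> i \<in> I \<Longrightarrow> j \<in> J \<Longrightarrow> g \<in> carrier G \<Longrightarrow> h \<in> carrier G \<Longrightarrow>
    h \<otimes> inv g \<notin> P \<Longrightarrow> M (i, g) (j, h) = 0"
  unfolding left_conv_def by blast

lemma right_conv_translate: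
  "right_conv I J M \<Longrightarrow> i \<in> I \<Longrightarrow> j \<in> J \<Longrightarrow> g \<in> carrier G \<Longrightarrow> h \<in> carrier G \<Longrightarrow>
    x \<in> carrier G \<Longrightarrow> M (i, x \<otimes> g) (j, x \<otimes> h) = M (i, g) (j, h)"
  unfolding right_conv_def by blast

lemma right_conv_eq_0:
  "right_conv I J M \<Longrightarrow> i \<in> I \<Longrightarrow> j \<in> J \<Longrightarrow> g \<in> carrier G \<Longrightarrow> h \<in> carrier G \<Longrightarrow>
    inv h \<otimes> g \<notin> Q \<Longrightarrow> M (i, g) (j, h) = 0"
  unfolding right_conv_def by blast

lemma left_conv_transpose: "left_conv I J M \<Longrightarrow> left_conv J I (mtx_transpose M)"
  unfolding left_conv_def mtx_transpose_def
  by (metis P.m_inv_closed inv_closed inv_inv inv_mult_group)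

lemma right_conv_transpose: "right_conv I J M \<Longrightarrow> right_conv J I (mtx_transpose M)"
  unfolding right_conv_def mtx_transpose_def
  by (metis Q.m_inv_closed inv_closed inv_inv inv_mult_group)

section \<open>Translations and commuting actions\<close>

lemma factor:
  assumes "g \<in> carrier G"
  obtains p q where "p \<in> P" "q \<in> Q" "g = p \<otimes> q"
  using assms unfolding factorisation[symmetric] by (auto simp: set_mult_def)

lemma sum_translate_right:
  assumes "x \<in> carrier G"
  shows "(\<Sum>h\<in>carrier G. f (h \<otimes> x)) = (\<Sum>h\<in>carrier G. f h)"
  by (rule sum.reindex_bij_witness[of _ "\<lambda>h. h \<otimes> inv x" "\<lambda>h. h \<otimes> x"])
    (use assms in \<open>auto simp: m_assoc\<close>)

lemma sum_translate_left:
  assumes "x \<in> carrier G"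
  shows "(\<Sum>h\<in>carrier G. f (x \<otimes> h)) = (\<Sum>h\<in>carrier G. f h)"
  by (rule sum.reindex_bij_witness[of _ "\<lambda>h. inv x \<otimes> h" "\<lambda>h. x \<otimes> h"])
    (use assms in \<open>auto simp flip: m_assoc\<close>)

text \<open>A right convolution by an element of the group algebra of \<open>Q\<close> is a linear combination of
  right translations by \<open>Q\<close>.\<close>

lemma right_conv_commute:
  assumes B: "right_conv K L B" and fin: "finite I" "finite L"
    and D: "\<And>i g h q. i \<in> I \<Longrightarrow> g \<in> carrier G \<Longrightarrow> h \<in> carrier G \<Longrightarrow> q \<in> Q \<Longrightarrow>
      D (g \<otimes> q) (i, h \<otimes> q) = D g (i, h)"
    and k: "k \<in> K" and g: "g \<in> carrier G"
  shows "(\<Sum>(l, h)\<in>L \<times> carrier G. B (k, g) (l, h) * (\<Sum>(i, h')\<in>I \<times> carrier G. D h (i, h') * v i l h'))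
    = (\<Sum>(i, h')\<in>I \<times> carrier G. D g (i, h') * (\<Sum>(l, h)\<in>L \<times> carrier G. B (k, h') (l, h) * v i l h))"
proof -
  \<comment> \<open>The row of \<open>B\<close> at \<open>x\<close> reads \<open>f\<close> only on
    the coset x Q, with coefficients that do not depend on \<open>x\<close>.\<close>
  have restrict: "(\<Sum>h\<in>carrier G. B (k, x) (l, h) * f h) =
      (\<Sum>q\<in>Q. B (k, \<one>) (l, q) * f (x \<otimes> q))" if "l \<in> L" "x \<in> carrier G" for l x f
  proof -
    have "(\<Sum>h\<in>carrier G. B (k, x) (l, h) * f h) =
        (\<Sum>h\<in>carrier G. B (k, x \<otimes> \<one>) (l, x \<otimes> h) * f (x \<otimes> h))"
      using that by (simp add: sum_translate_left[of x "\<lambda>h. B (k, x) (l, h) * f h"])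
    also have "\<dots> = (\<Sum>h\<in>carrier G. B (k, \<one>) (l, h) * f (x \<otimes> h))"
    proof (intro sum.cong refl)
      fix h assume "h \<in> carrier G"
      then have "B (k, x \<otimes> \<one>) (l, x \<otimes> h) = B (k, \<one>) (l, h)"
        using B that k by (intro right_conv_translate) auto
      then show "B (k, x \<otimes> \<one>) (l, x \<otimes> h) * f (x \<otimes> h) = B (k, \<one>) (l, h) * f (x \<otimes> h)"
        by simp
    qed
    also have "\<dots> = (\<Sum>q\<in>Q. B (k, \<one>) (l, q) * f (x \<otimes> q))"
    proof (rule sum.mono_neutral_right)
      show "\<forall>h\<in>carrier G - Q. B (k, \<one>) (l, h) * f (x \<otimes> h) = 0"
      proof
        fix h assume h: "h \<in> carrier G - Q"
        then have "inv h \<otimes> \<one> \<notin> Q" by (metis DiffE Q.m_inv_closed inv_closed inv_inv r_one)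
        then show "B (k, \<one>) (l, h) * f (x \<otimes> h) = 0"
          using right_conv_eq_0[OF B k \<open>l \<in> L\<close>] h by simp
      qed
    qed (use finite_carrier Q.subset in auto)
    finally show ?thesis .
  qed
  \<comment> \<open>Substituting \<open>h' \<otimes> q\<close> for \<open>h'\<close> and using the
    invariance of \<open>D\<close> under \<open>Q\<close> moves the translation from
    \<open>D\<close> to \<open>v\<close>.\<close>
  have shift: "(\<Sum>h'\<in>carrier G. D (g \<otimes> q) (i, h') * v i l h') =
      (\<Sum>h'\<in>carrier G. D g (i, h') * v i l (h' \<otimes> q))" if "i \<in> I" "q \<in> Q" for i l q
    using that g D by (subst sum_translate_right[of q, symmetric]) auto
  have "(\<Sum>(l, h)\<in>L \<times> carrier G. B (k, g) (l, h) * (\<Sum>(i, h')\<in>I \<times> carrier G. D h (i, h') * v i l h'))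
     = (\<Sum>l\<in>L. \<Sum>h\<in>carrier G. B (k, g) (l, h) * (\<Sum>i\<in>I. \<Sum>h'\<in>carrier G. D h (i, h') * v i l h'))"
    by (simp add: sum.cartesian_product)
  also have "\<dots> = (\<Sum>l\<in>L. \<Sum>q\<in>Q. B (k, \<one>) (l, q) *
      (\<Sum>i\<in>I. \<Sum>h'\<in>carrier G. D (g \<otimes> q) (i, h') * v i l h'))"
    using g by (intro sum.cong refl restrict)
  also have "\<dots> = (\<Sum>l\<in>L. \<Sum>q\<in>Q. \<Sum>i\<in>I. \<Sum>h'\<in>carrier G.
      D g (i, h') * (B (k, \<one>) (l, q) * v i l (h' \<otimes> q)))"
    by (intro sum.cong refl) (simp add: shift sum_distrib_left mult.left_commute)
  also have "\<dots> = (\<Sum>i\<in>I. \<Sum>h'\<in>carrier G. \<Sum>l\<in>L. \<Sum>q\<in>Q.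
      D g (i, h') * (B (k, \<one>) (l, q) * v i l (h' \<otimes> q)))"
    unfolding sum.cartesian_product
    by (rule sum.reindex_bij_witness[of _ "\<lambda>(i, h, l, q). (l, q, i, h)" "\<lambda>(l, q, i, h). (i, h, l, q)"])
      auto
  also have "\<dots> = (\<Sum>i\<in>I. \<Sum>h'\<in>carrier G. D g (i, h') *
      (\<Sum>l\<in>L. \<Sum>h\<in>carrier G. B (k, h') (l, h) * v i l h))"
    by (intro sum.cong refl) (simp add: restrict sum_distrib_left)
  finally show ?thesis by (simp add: sum.cartesian_product)
qed

section \<open>Trivial kernels on saturated supports\<close>

lemma left_conv_kernel_trivial:
  assumes M: "left_conv I J M" and "finite J"
    and sat: "\<And>j g q. (j, g \<otimes> q) \<in> S \<Longrightarrow> j \<in> J \<Longrightarrow> g \<in> carrier G \<Longrightarrow> q \<in> Q \<Longrightarrow> (j, g) \<in> S"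
    and base: "\<And>y. y \<in> ker_code (I \<times> P) (J \<times> P) M \<Longrightarrow> {c. y c \<noteq> 0} \<subseteq> S \<Longrightarrow> y = (\<lambda>_. 0)"
    and x: "x \<in> ker_code (I \<times> carrier G) (J \<times> carrier G) M" "{c. x c \<noteq> 0} \<subseteq> S"
  shows "x = (\<lambda>_. 0)"
proof (rule kernel_trivial_by_translation[where T = Q and S = S and C\<^sub>0 = "J \<times> P" and R\<^sub>0 = "I \<times> P"
      and \<phi> = "\<lambda>q (j, g). (j, g \<otimes> q)" and \<psi> = "\<lambda>q (i, g). (i, g \<otimes> q)", OF _ _ _ _ _ _ _ _ _ x])
  \<comment> \<open>Since G = PQ, every right coset of \<open>P\<close> has the form P q with q in
    \<open>Q\<close>; \<open>M\<close> preserves these cosets and acts on each as on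
    \<open>P\<close>.\<close>
  show "J \<times> carrier G \<subseteq> (\<Union>q\<in>Q. (\<lambda>(j, g). (j, g \<otimes> q)) ` (J \<times> P))"
  proof clarify
    fix j g assume "j \<in> J" "g \<in> carrier G"
    moreover obtain p q where "p \<in> P" "q \<in> Q" "g = p \<otimes> q" using factor[OF \<open>g \<in> carrier G\<close>] .
    ultimately show "(j, g) \<in> (\<Union>q\<in>Q. (\<lambda>(j, g). (j, g \<otimes> q)) ` (J \<times> P))" by force
  qed
next
  fix q r c
  assume q: "q \<in> Q" and "r \<in> I \<times> P" and c: "c \<in> J \<times> carrier G - (\<lambda>(j, g). (j, g \<otimes> q)) ` (J \<times> P)"
  then obtain i p j h where [simp]: "r = (i, p)" "c = (j, h)"
    and i: "i \<in> I" "p \<in> P" and j: "j \<in> J" "h \<in> carrier G"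
    by auto
  \<comment> \<open>Otherwise \<open>h\<close> would lie in P p q = P q, that is, in the copy
    excluded by the choice of \<open>c\<close>.\<close>
  have "h \<otimes> inv (p \<otimes> q) \<notin> P"
  proof
    assume "h \<otimes> inv (p \<otimes> q) \<in> P"
    then have "h \<otimes> inv (p \<otimes> q) \<otimes> p \<in> P" using i by simp
    moreover have "h \<otimes> inv (p \<otimes> q) \<otimes> p \<otimes> q = h"
      using i q j by (simp add: m_assoc)
    ultimately show False using c j by force
  qed
  then show "M ((\<lambda>(i, g). (i, g \<otimes> q)) r) c = 0"
    using M i j q by (simp add: left_conv_eq_0)
next
  fix q assume "q \<in> Q"
  then show "inj_on (\<lambda>(j, g). (j, g \<otimes> q)) (J \<times> P)"
    by (auto simp: inj_on_def)
next
  fix q c assume "q \<in> Q" "c \<in> J \<times> P" "(\<lambda>(j, g). (j, g \<otimes> q)) c \<in> S"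
  then show "c \<in> S" using sat by auto
next
  fix q r c assume "q \<in> Q" "r \<in> I \<times> P" "c \<in> J \<times> P"
  then show "M ((\<lambda>(i, g). (i, g \<otimes> q)) r) ((\<lambda>(j, g). (j, g \<otimes> q)) c) = M r c"
    using left_conv_translate[OF M] by auto
qed (use assms(2) finite_carrier base in auto)

text \<open>The mirror image: \<open>B\<close> preserves the left cosets p Q, these exhaust the
  group for p in \<open>P\<close>, and left translation by p identifies each with
  \<open>Q\<close>.\<close>

lemma right_conv_kernel_trivial:
  assumes M: "right_conv I J M" and "finite J"
    and sat: "\<And>j g p. (j, p \<otimes> g) \<in> S \<Longrightarrow> j \<in> J \<Longrightarrow> g \<in> carrier G \<Longrightarrow> p \<in> P \<Longrightarrow> (j, g) \<in> S"
    and base: "\<And>y. y \<in> ker_code (I \<times> Q) (J \<times> Q) M \<Longrightarrow> {c. y c \<noteq> 0} \<subseteq> S \<Longrightarrow> y = (\<lambda>_. 0)"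
    and x: "x \<in> ker_code (I \<times> carrier G) (J \<times> carrier G) M" "{c. x c \<noteq> 0} \<subseteq> S"
  shows "x = (\<lambda>_. 0)"
proof (rule kernel_trivial_by_translation[where T = P and S = S and C\<^sub>0 = "J \<times> Q" and R\<^sub>0 = "I \<times> Q"
      and \<phi> = "\<lambda>p (j, g). (j, p \<otimes> g)" and \<psi> = "\<lambda>p (i, g). (i, p \<otimes> g)", OF _ _ _ _ _ _ _ _ _ x])
  show "J \<times> carrier G \<subseteq> (\<Union>p\<in>P. (\<lambda>(j, g). (j, p \<otimes> g)) ` (J \<times> Q))"
  proof clarify
    fix j g assume "j \<in> J" "g \<in> carrier G"
    moreover obtain p q where "p \<in> P" "q \<in> Q" "g = p \<otimes> q" using factor[OF \<open>g \<in> carrier G\<close>] .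
    ultimately show "(j, g) \<in> (\<Union>p\<in>P. (\<lambda>(j, g). (j, p \<otimes> g)) ` (J \<times> Q))" by force
  qed
next
  fix p r c
  assume p: "p \<in> P" and "r \<in> I \<times> Q" and c: "c \<in> J \<times> carrier G - (\<lambda>(j, g). (j, p \<otimes> g)) ` (J \<times> Q)"
  then obtain i q j h where [simp]: "r = (i, q)" "c = (j, h)"
    and i: "i \<in> I" "q \<in> Q" and j: "j \<in> J" "h \<in> carrier G"
    by auto
  have "inv h \<otimes> (p \<otimes> q) \<notin> Q"
  proof
    assume "inv h \<otimes> (p \<otimes> q) \<in> Q"
    then have "q \<otimes> inv (inv h \<otimes> (p \<otimes> q)) \<in> Q" using i by simp
    moreover have "p \<otimes> (q \<otimes> inv (inv h \<otimes> (p \<otimes> q))) = h"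
      using i p j by (simp add: inv_mult_group m_assoc flip: m_assoc[of p] m_assoc[of q])
    ultimately show False using c j by force
  qed
  then show "M ((\<lambda>(i, g). (i, p \<otimes> g)) r) c = 0"
    using M i j p by (simp add: right_conv_eq_0)
next
  fix p assume "p \<in> P"
  then show "inj_on (\<lambda>(j, g). (j, p \<otimes> g)) (J \<times> Q)"
    by (auto simp: inj_on_def)
next
  fix p c assume "p \<in> P" "c \<in> J \<times> Q" "(\<lambda>(j, g). (j, p \<otimes> g)) c \<in> S"
  then show "c \<in> S" using sat by auto
next
  fix p r c assume "p \<in> P" "r \<in> I \<times> Q" "c \<in> J \<times> Q"
  then show "M ((\<lambda>(i, g). (i, p \<otimes> g)) r) ((\<lambda>(j, g). (j, p \<otimes> g)) c) = M r c"
    using right_conv_translate[OF M] by auto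
qed (use assms(2) finite_carrier base in auto)

text \<open>Maschke's theorem for the partial left inverse. Equivariance under \<open>Q\<close>, the
  group under which \<open>S\<close> is saturated, lets \<open>D\<close> commute with right
  convolutions over \<open>Q\<close>. The support condition keeps \<open>D\<close> inside right
  cosets of \<open>P\<close>, so it does not enlarge supports saturated under
  \<open>P\<close>.\<close>

lemma equivariant_left_inverse:
  fixes M :: "'i \<times> 'a \<Rightarrow> 'j \<times> 'a \<Rightarrow> 'f::field"
  assumes M: "left_conv I J M" and fin: "finite I" "finite J"
    and Q0: "of_nat (card Q) \<noteq> (0 :: 'f)"
    and S: "S \<subseteq> J \<times> carrier G"
    and sat: "\<And>j g q. j \<in> J \<Longrightarrow> g \<in> carrier G \<Longrightarrow> q \<in> Q \<Longrightarrow> (j, g \<otimes> q) \<in> S \<longleftrightarrow> (j, g) \<in> S"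
    and triv: "\<And>x. x \<in> ker_code (I \<times> carrier G) (J \<times> carrier G) M \<Longrightarrow> {c. x c \<noteq> 0} \<subseteq> S \<Longrightarrow> x = (\<lambda>_. 0)"
  obtains D :: "'j \<times> 'a \<Rightarrow> 'i \<times> 'a \<Rightarrow> 'f" where
    "\<And>j g i h q. g \<in> carrier G \<Longrightarrow> h \<in> carrier G \<Longrightarrow> q \<in> Q \<Longrightarrow> D (j, g \<otimes> q) (i, h \<otimes> q) = D (j, g) (i, h)"
    "\<And>j g i h. D (j, g) (i, h) \<noteq> 0 \<Longrightarrow> h \<otimes> inv g \<in> P"
    "\<And>x j g. {c. x c \<noteq> 0} \<subseteq> S \<Longrightarrow> j \<in> J \<Longrightarrow> g \<in> carrier G \<Longrightarrow>
       (\<Sum>(i, h)\<in>I \<times> carrier G. D (j, g) (i, h) *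
         (\<Sum>(j', h')\<in>J \<times> carrier G. M (i, h) (j', h') * x (j', h'))) = x (j, g)"
proof -
  obtain K :: "'j \<times> 'a \<Rightarrow> 'i \<times> 'a \<Rightarrow> 'f" where K: "\<And>x c. {c. x c \<noteq> 0} \<subseteq> S \<Longrightarrow>
      (\<Sum>r\<in>I \<times> carrier G. K c r * (\<Sum>c'\<in>J \<times> carrier G. M r c' * x c')) = x c"
    using left_inverse_kernel[of "I \<times> carrier G" "J \<times> carrier G" S M] S triv fin finite_carrier
    by blast
  \<comment> \<open>Maschke averaging over \<open>Q\<close>; cutting down to the blocks of right cosets of \<open>P\<close>, which \<open>M\<close> preserves,
    keeps a left inverse.\<close>
  define D where "D = (\<lambda>(j, g) (i, h). if h \<otimes> inv g \<in> P
      then (\<Sum>q\<in>Q. K (j, g \<otimes> q) (i, h \<otimes> q)) / of_nat (card Q) else 0)"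
  show ?thesis
  proof
    fix j g i h q assume *: "g \<in> carrier G" "h \<in> carrier G" "q \<in> Q"
    have "(\<Sum>q'\<in>Q. K (j, g \<otimes> q \<otimes> q') (i, h \<otimes> q \<otimes> q')) = (\<Sum>q'\<in>Q. K (j, g \<otimes> q') (i, h \<otimes> q'))"
      by (rule sum.reindex_bij_witness[of _ "\<lambda>q'. inv q \<otimes> q'" "\<lambda>q'. q \<otimes> q'"])
        (use * in \<open>auto simp: m_assoc simp flip: m_assoc[of "inv q"] m_assoc[of q]\<close>)
    moreover have "h \<otimes> q \<otimes> inv (g \<otimes> q) = h \<otimes> inv g"
      using * by (simp add: inv_mult_group m_assoc flip: m_assoc[of q])
    ultimately show "D (j, g \<otimes> q) (i, h \<otimes> q) = D (j, g) (i, h)"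
      by (simp add: D_def)
  next
    fix j g i h assume "D (j, g) (i, h) \<noteq> 0"
    then show "h \<otimes> inv g \<in> P" by (auto simp: D_def split: if_splits)
  next
    fix x :: "'j \<times> 'a \<Rightarrow> 'f" and j g
    assume x: "{c. x c \<noteq> 0} \<subseteq> S" and j: "j \<in> J" and g: "g \<in> carrier G"
    define y where "y = (\<lambda>i h. \<Sum>(j', h')\<in>J \<times> carrier G. M (i, h) (j', h') * x (j', h'))"
    \<comment> \<open>Every single term of the average, cut down to the coset P g, already recovers
      \<open>x (j, g)\<close>.\<close>
    have translate: "(\<Sum>(i, h)\<in>I \<times> carrier G.
        (if h \<otimes> inv g \<in> P then K (j, g \<otimes> q) (i, h \<otimes> q) * y i h else 0)) = x (j, g)" if q: "q \<in> Q" for q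
    proof -
      \<comment> \<open>The part of \<open>x\<close> on the coset P g, translated by
        \<open>q\<close>. Saturation keeps it supported in \<open>S\<close>, so \<open>K\<close>
        inverts \<open>M\<close> on it.\<close>
      define z where "z = (\<lambda>(j', h). if j' \<in> J \<and> h \<in> carrier G \<and> h \<otimes> inv q \<otimes> inv g \<in> P
          then x (j', h \<otimes> inv q) else 0)"
      have zS: "{c. z c \<noteq> 0} \<subseteq> S"
      proof clarify
        fix j' h assume "z (j', h) \<noteq> 0"
        then have "j' \<in> J" "h \<in> carrier G" "(j', h \<otimes> inv q) \<in> S"
          using x by (auto simp: z_def split: if_splits)
        then show "(j', h) \<in> S" using sat[of j' h "inv q"] q by simp
      qed
      \<comment> \<open>As \<open>M\<close> commutes with right translations and preserves right
        cosets of \<open>P\<close>, the image of \<open>z\<close> is the part of \<open>y\<close> on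
        P g, translated by \<open>q\<close>.\<close>
      have Mz: "(\<Sum>(j', h')\<in>J \<times> carrier G. M (i, h \<otimes> q) (j', h') * z (j', h')) =
          (if h \<otimes> inv g \<in> P then y i h else 0)" if ih: "i \<in> I" "h \<in> carrier G" for i h
      proof -
        have "(\<Sum>(j', h')\<in>J \<times> carrier G. M (i, h \<otimes> q) (j', h') * z (j', h')) =
            (\<Sum>j'\<in>J. \<Sum>h'\<in>carrier G. M (i, h \<otimes> q) (j', h' \<otimes> q) * z (j', h' \<otimes> q))"
          unfolding sum.cartesian_product[symmetric] using q
          by (intro sum.cong refl
              sum_translate_right[where f = "\<lambda>h'. M (i, h \<otimes> q) (_, h') * z (_, h')", symmetric]) auto
        also have "\<dots> = (\<Sum>j'\<in>J. \<Sum>h'\<in>carrier G.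
            if h \<otimes> inv g \<in> P then M (i, h) (j', h') * x (j', h') else 0)"
        proof (intro sum.cong refl)
          fix j' h' assume jh: "j' \<in> J" "h' \<in> carrier G"
          have inv: "M (i, h \<otimes> q) (j', h' \<otimes> q) = M (i, h) (j', h')"
            using M jh ih q by (simp add: left_conv_translate)
          have z: "z (j', h' \<otimes> q) = (if h' \<otimes> inv g \<in> P then x (j', h') else 0)"
            using jh q by (simp add: z_def m_assoc)
          \<comment> \<open>A nonzero entry forces \<open>h\<close> and \<open>h'\<close> into the
            same right coset of \<open>P\<close>, so the two cutoffs agree.\<close>
          have "h' \<otimes> inv g \<in> P \<longleftrightarrow> h \<otimes> inv g \<in> P" if "M (i, h) (j', h') \<noteq> 0"
          proof -
            have hh: "h' \<otimes> inv h \<in> P" using left_conv_eq_0[OF M] ih jh that by blast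
            have "h' \<otimes> inv g = (h' \<otimes> inv h) \<otimes> (h \<otimes> inv g)"
              using ih jh g by (simp add: m_assoc flip: m_assoc[of "inv h"])
            moreover have "h \<otimes> inv g = inv (h' \<otimes> inv h) \<otimes> (h' \<otimes> inv g)"
              using ih jh g by (simp add: inv_mult_group m_assoc flip: m_assoc[of "inv h'"])
            ultimately show ?thesis using hh by (metis P.m_closed P.m_inv_closed)
          qed
          then show "M (i, h \<otimes> q) (j', h' \<otimes> q) * z (j', h' \<otimes> q) =
              (if h \<otimes> inv g \<in> P then M (i, h) (j', h') * x (j', h') else 0)"
            unfolding inv z by auto
        qed
        also have "\<dots> = (if h \<otimes> inv g \<in> P then y i h else 0)"
          by (simp add: y_def sum.cartesian_product)
        finally show ?thesis .
      qed
      have "(\<Sum>(i, h)\<in>I \<times> carrier G.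
          (if h \<otimes> inv g \<in> P then K (j, g \<otimes> q) (i, h \<otimes> q) * y i h else 0)) =
        (\<Sum>i\<in>I. \<Sum>h\<in>carrier G. K (j, g \<otimes> q) (i, h \<otimes> q) *
          (\<Sum>(j', h')\<in>J \<times> carrier G. M (i, h \<otimes> q) (j', h') * z (j', h')))"
        unfolding sum.cartesian_product[symmetric] by (intro sum.cong refl)
          (simp add: Mz[unfolded sum.cartesian_product[symmetric]])
      also have "\<dots> = (\<Sum>i\<in>I. \<Sum>h\<in>carrier G. K (j, g \<otimes> q) (i, h) *
          (\<Sum>(j', h')\<in>J \<times> carrier G. M (i, h) (j', h') * z (j', h')))"
        using q by (intro sum.cong refl sum_translate_right[where f = "\<lambda>h. K (j, g \<otimes> q) (_, h) *
          (\<Sum>(j', h')\<in>J \<times> carrier G. M (_, h) (j', h') * z (j', h'))"]) auto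
      also have "\<dots> = z (j, g \<otimes> q)"
        using K[OF zS, of "(j, g \<otimes> q)"] by (simp add: sum.cartesian_product case_prod_unfold)
      also have "\<dots> = x (j, g)" using j g q by (simp add: z_def m_assoc)
      finally show ?thesis .
    qed
    have "(\<Sum>(i, h)\<in>I \<times> carrier G. D (j, g) (i, h) * y i h) =
        (\<Sum>(i, h)\<in>I \<times> carrier G. \<Sum>q\<in>Q.
          (if h \<otimes> inv g \<in> P then K (j, g \<otimes> q) (i, h \<otimes> q) * y i h else 0) / of_nat (card Q))"
      by (intro sum.cong refl) (auto simp: D_def sum_distrib_right sum_divide_distrib)
    also have "\<dots> = (\<Sum>q\<in>Q. (\<Sum>(i, h)\<in>I \<times> carrier G.
          (if h \<otimes> inv g \<in> P then K (j, g \<otimes> q) (i, h \<otimes> q) * y i h else 0)) / of_nat (card Q))"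
      unfolding case_prod_unfold by (subst sum.swap) (simp add: sum_divide_distrib)
    \<comment> \<open>The average consists of |Q| equal terms; invertibility of |Q| in the field
      enters here.\<close>
    also have "\<dots> = x (j, g)" using Q0 by (simp add: translate)
    finally show "(\<Sum>(i, h)\<in>I \<times> carrier G. D (j, g) (i, h) *
         (\<Sum>(j', h')\<in>J \<times> carrier G. M (i, h) (j', h') * x (j', h'))) = x (j, g)"
      by (simp add: y_def)
  qed
qed

section \<open>Low-weight cycles are boundaries\<close>

lemma hamming_weight_le_mult:
  assumes "finite {a. u a \<noteq> 0}" and "{c. y c \<noteq> 0} \<subseteq> (\<Union>a\<in>{a. u a \<noteq> 0}. F a)"
    and "\<And>a. u a \<noteq> 0 \<Longrightarrow> finite (F a) \<and> card (F a) \<le> m"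
  shows "hamming_weight y \<le> hamming_weight u * m"
proof -
  have "card {c. y c \<noteq> 0} \<le> card (\<Union>a\<in>{a. u a \<noteq> 0}. F a)"
    using assms by (intro card_mono) auto
  also have "\<dots> \<le> (\<Sum>a\<in>{a. u a \<noteq> 0}. card (F a))" by (rule card_UN_le[OF assms(1)])
  also have "\<dots> \<le> (\<Sum>a\<in>{a. u a \<noteq> 0}. m)" using assms by (intro sum_mono) auto
  finally show ?thesis by (simp add: hamming_weight_def)
qed

text \<open>Exactness in low weight at the middle of the complex that sends w to (B w, M w) and (u,
  v) to M u - B v. Arbitrary convolution matrices are allowed so that the result covers
  \<open>A\<close> and \<open>B\<close> as well as their transposes.\<close>

lemma low_weight_cycle_is_boundary:
  fixes M :: "'i \<times> 'a \<Rightarrow> 'j \<times> 'a \<Rightarrow> 'f::field" and B :: "'k \<times> 'a \<Rightarrow> 'l \<times> 'a \<Rightarrow> 'f"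
  assumes M: "left_conv I J M" and B: "right_conv K L B"
    and fin: "finite I" "finite J" "finite K" "finite L"
    and Q0: "of_nat (card Q) \<noteq> (0 :: 'f)"
    and u: "{c. u c \<noteq> 0} \<subseteq> (J \<times> K) \<times> carrier G"
    and v: "{c. v c \<noteq> 0} \<subseteq> (I \<times> L) \<times> carrier G"
    and cycle: "\<And>i k g. i \<in> I \<Longrightarrow> k \<in> K \<Longrightarrow> g \<in> carrier G \<Longrightarrow>
      (\<Sum>(j, h)\<in>J \<times> carrier G. M (i, g) (j, h) * u ((j, k), h)) =
      (\<Sum>(l, h)\<in>L \<times> carrier G. B (k, g) (l, h) * v ((i, l), h))"
    and distM: "\<And>x. x \<in> ker_code (I \<times> P) (J \<times> P) M \<Longrightarrow>
      hamming_weight x \<le> hamming_weight u * card (P \<inter> Q) \<Longrightarrow> x = (\<lambda>_. 0)"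
    and distB: "\<And>x. x \<in> ker_code (K \<times> Q) (L \<times> Q) B \<Longrightarrow>
      hamming_weight x \<le> hamming_weight v * card (P \<inter> Q) \<Longrightarrow> x = (\<lambda>_. 0)"
  shows "\<exists>w. (\<forall>j\<in>J. \<forall>k\<in>K. \<forall>g\<in>carrier G.
      u ((j, k), g) = (\<Sum>(l, h)\<in>L \<times> carrier G. B (k, g) (l, h) * w ((j, l), h))) \<and>
    (\<forall>i\<in>I. \<forall>l\<in>L. \<forall>g\<in>carrier G.
      v ((i, l), g) = (\<Sum>(j, h)\<in>J \<times> carrier G. M (i, g) (j, h) * w ((j, l), h)))"
proof -
  \<comment> \<open>The supports of \<open>u\<close> and \<open>v\<close>, saturated under right translation by \<open>Q\<close> and left translation by \<open>P\<close>.\<close>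
  define S where "S = {(j, g). j \<in> J \<and> g \<in> carrier G \<and> (\<exists>q\<in>Q. \<exists>k. u ((j, k), g \<otimes> q) \<noteq> 0)}"
  define T where "T = {(l, g). l \<in> L \<and> g \<in> carrier G \<and> (\<exists>p\<in>P. \<exists>i. v ((i, l), p \<otimes> g) \<noteq> 0)}"
  have finPQ: "finite P" "finite Q"
    using P.subset Q.subset finite_carrier finite_subset by blast+
  have finu: "finite {c. u c \<noteq> 0}" and finv: "finite {c. v c \<noteq> 0}"
    using fin finite_carrier by (auto intro: finite_subset[OF u] finite_subset[OF v])

  have uS: "{c. (\<lambda>(j, g). u ((j, k), g)) c \<noteq> 0} \<subseteq> S" for k
  proof clarify
    fix j g assume nz: "u ((j, k), g) \<noteq> 0"
    then have "j \<in> J" "g \<in> carrier G" using u by auto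
    then show "(j, g) \<in> S" using nz by (auto simp: S_def intro!: bexI[of _ \<one>])
  qed
  have satS: "(j, g \<otimes> q) \<in> S \<longleftrightarrow> (j, g) \<in> S" if "j \<in> J" "g \<in> carrier G" "q \<in> Q" for j g q
  proof
    assume "(j, g \<otimes> q) \<in> S"
    then obtain q' k where "q' \<in> Q" "u ((j, k), g \<otimes> q \<otimes> q') \<noteq> 0" by (auto simp: S_def)
    then show "(j, g) \<in> S"
      using that by (auto simp: S_def m_assoc intro!: bexI[of _ "q \<otimes> q'"])
  next
    assume "(j, g) \<in> S"
    then obtain q' k where "q' \<in> Q" "u ((j, k), g \<otimes> q') \<noteq> 0" by (auto simp: S_def)
    moreover have "g \<otimes> q \<otimes> (inv q \<otimes> q') = g \<otimes> q'" if "q' \<in> Q" for q'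
      using that \<open>g \<in> carrier G\<close> \<open>q \<in> Q\<close> by (simp add: m_assoc flip: m_assoc[of q])
    ultimately show "(j, g \<otimes> q) \<in> S"
      using that by (auto simp: S_def intro!: bexI[of _ "inv q \<otimes> q'"])
  qed
  have trivM: "x = (\<lambda>_. 0)"
    if "x \<in> ker_code (I \<times> carrier G) (J \<times> carrier G) M" "{c. x c \<noteq> 0} \<subseteq> S" for x
  proof (rule left_conv_kernel_trivial[OF M \<open>finite J\<close> _ _ that])
    fix y assume y: "y \<in> ker_code (I \<times> P) (J \<times> P) M" "{c. y c \<noteq> 0} \<subseteq> S"
    show "y = (\<lambda>_. 0)"
    proof (rule distM[OF y(1)], rule hamming_weight_le_mult[OF finu])
      \<comment> \<open>A nonzero position \<open>(j, p)\<close> of \<open>y\<close> is charged to a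
        point \<open>((j, k), p \<otimes> q)\<close> in the support of \<open>u\<close>. A point
        with group coordinate g is charged only for p in P \<inter> gQ, at most |P \<inter> Q|
        times.\<close>
      show "{c. y c \<noteq> 0} \<subseteq> (\<Union>a\<in>{a. u a \<noteq> 0}. {fst (fst a)} \<times> {p \<in> P. inv p \<otimes> snd a \<in> Q})"
      proof clarify
        fix j p assume nz: "y (j, p) \<noteq> 0"
        then have p: "p \<in> P" using y(1) by (auto simp: ker_code_def)
        from nz y(2) obtain q k where q: "q \<in> Q" "u ((j, k), p \<otimes> q) \<noteq> 0"
          by (auto simp: S_def)
        have "inv p \<otimes> (p \<otimes> q) = q" using p q by (simp flip: m_assoc)
        then show "(j, p) \<in> (\<Union>a\<in>{a. u a \<noteq> 0}. {fst (fst a)} \<times> {p \<in> P. inv p \<otimes> snd a \<in> Q})"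
          using p q by (intro UN_I[of "((j, k), p \<otimes> q)"]) auto
      qed
      fix a assume "u a \<noteq> 0"
      then show "finite ({fst (fst a)} \<times> {p \<in> P. inv p \<otimes> snd a \<in> Q}) \<and>
          card ({fst (fst a)} \<times> {p \<in> P. inv p \<otimes> snd a \<in> Q}) \<le> card (P \<inter> Q)"
        using finPQ u card_coset_section_le[OF subgroup_P subgroup_Q finite_carrier, of "snd a"]
        by (auto simp: card_cartesian_product)
    qed
  qed (use satS in blast)

  have vT: "{c. (\<lambda>(l, g). v ((i, l), g)) c \<noteq> 0} \<subseteq> T" for i
  proof clarify
    fix l g assume nz: "v ((i, l), g) \<noteq> 0"
    then have "l \<in> L" "g \<in> carrier G" using v by auto
    then show "(l, g) \<in> T" using nz by (auto simp: T_def intro!: bexI[of _ \<one>])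
  qed
  have trivB: "x = (\<lambda>_. 0)"
    if "x \<in> ker_code (K \<times> carrier G) (L \<times> carrier G) B" "{c. x c \<noteq> 0} \<subseteq> T" for x
  proof (rule right_conv_kernel_trivial[OF B \<open>finite L\<close> _ _ that])
    fix l g p assume "(l, p \<otimes> g) \<in> T" "l \<in> L" "g \<in> carrier G" "p \<in> P"
    then show "(l, g) \<in> T" by (force simp: T_def simp flip: m_assoc)
  next
    fix y assume y: "y \<in> ker_code (K \<times> Q) (L \<times> Q) B" "{c. y c \<noteq> 0} \<subseteq> T"
    show "y = (\<lambda>_. 0)"
    proof (rule distB[OF y(1)], rule hamming_weight_le_mult[OF finv])
      \<comment> \<open>The same charging with the sides exchanged: \<open>(l, q)\<close> is charged
        to some \<open>((i, l), p \<otimes> q)\<close> in the support of \<open>v\<close>.\<close>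
      show "{c. y c \<noteq> 0} \<subseteq> (\<Union>a\<in>{a. v a \<noteq> 0}. {snd (fst a)} \<times> {q \<in> Q. snd a \<otimes> inv q \<in> P})"
      proof clarify
        fix l q assume nz: "y (l, q) \<noteq> 0"
        then have q: "q \<in> Q" using y(1) by (auto simp: ker_code_def)
        from nz y(2) obtain p i where p: "p \<in> P" "v ((i, l), p \<otimes> q) \<noteq> 0"
          by (auto simp: T_def)
        have "p \<otimes> q \<otimes> inv q = p" using p q by (simp add: m_assoc)
        then show "(l, q) \<in> (\<Union>a\<in>{a. v a \<noteq> 0}. {snd (fst a)} \<times> {q \<in> Q. snd a \<otimes> inv q \<in> P})"
          using p q by (intro UN_I[of "((i, l), p \<otimes> q)"]) auto
      qed
      fix a assume "v a \<noteq> 0"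
      then have a: "snd a \<in> carrier G" using v by auto
      \<comment> \<open>Inversion turns right cosets of \<open>P\<close> into left cosets, so the
        coset bound applies with \<open>P\<close> and \<open>Q\<close> exchanged.\<close>
      have "card {q \<in> Q. snd a \<otimes> inv q \<in> P} \<le> card {q \<in> Q. inv q \<otimes> inv (snd a) \<in> P}"
      proof (rule card_inj_on_le)
        show "inj_on (\<lambda>q. inv q) {q \<in> Q. snd a \<otimes> inv q \<in> P}"
          by (rule inj_onI) (metis (mono_tags, lifting) Q.mem_carrier inv_inv mem_Collect_eq)
        show "(\<lambda>q. inv q) ` {q \<in> Q. snd a \<otimes> inv q \<in> P} \<subseteq> {q \<in> Q. inv q \<otimes> inv (snd a) \<in> P}"
        proof clarify
          fix q assume q: "q \<in> Q" "snd a \<otimes> inv q \<in> P"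
          then have "inv (inv q) \<otimes> inv (snd a) = inv (snd a \<otimes> inv q)"
            using a by (simp add: inv_mult_group)
          then show "inv q \<in> Q \<and> inv (inv q) \<otimes> inv (snd a) \<in> P" using q by simp
        qed
      qed (use finPQ in simp)
      also have "\<dots> \<le> card (P \<inter> Q)"
        using card_coset_section_le[OF subgroup_Q subgroup_P finite_carrier, of "inv (snd a)"] a
        by (simp add: Int_commute)
      finally show "finite ({snd (fst a)} \<times> {q \<in> Q. snd a \<otimes> inv q \<in> P}) \<and>
          card ({snd (fst a)} \<times> {q \<in> Q. snd a \<otimes> inv q \<in> P}) \<le> card (P \<inter> Q)"
        using finPQ by (auto simp: card_cartesian_product)
    qed
  qed

  obtain D :: "'j \<times> 'a \<Rightarrow> 'i \<times> 'a \<Rightarrow> 'f" where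
    D_translate: "\<And>j g i h q. g \<in> carrier G \<Longrightarrow> h \<in> carrier G \<Longrightarrow> q \<in> Q \<Longrightarrow>
      D (j, g \<otimes> q) (i, h \<otimes> q) = D (j, g) (i, h)"
    and D_P: "\<And>j g i h. D (j, g) (i, h) \<noteq> 0 \<Longrightarrow> h \<otimes> inv g \<in> P"
    and D_inverse: "\<And>x j g. {c. x c \<noteq> 0} \<subseteq> S \<Longrightarrow> j \<in> J \<Longrightarrow> g \<in> carrier G \<Longrightarrow>
       (\<Sum>(i, h)\<in>I \<times> carrier G. D (j, g) (i, h) *
         (\<Sum>(j', h')\<in>J \<times> carrier G. M (i, h) (j', h') * x (j', h'))) = x (j, g)"
    using equivariant_left_inverse[OF M fin(1,2) Q0 _ satS trivM] by (auto simp: S_def)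
  \<comment> \<open>\<open>D\<close> acts on the \<open>I\<close> index of \<open>v\<close> and
    leaves the \<open>L\<close> index alone.\<close>
  define w where "w = (\<lambda>((j, l), g). \<Sum>(i, h)\<in>I \<times> carrier G. D (j, g) (i, h) * v ((i, l), h))"

  \<comment> \<open>B w = B D v = D B v = D M u = u, where the last equality holds because each
    slice of \<open>u\<close> at fixed k is supported in \<open>S\<close>.\<close>
  have Bw: "(\<Sum>(l, h)\<in>L \<times> carrier G. B (k, g) (l, h) * w ((j, l), h)) = u ((j, k), g)"
    if "j \<in> J" "k \<in> K" "g \<in> carrier G" for j k g
  proof -
    have "(\<Sum>(l, h)\<in>L \<times> carrier G. B (k, g) (l, h) * w ((j, l), h)) =
        (\<Sum>(i, h')\<in>I \<times> carrier G. D (j, g) (i, h') *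
          (\<Sum>(l, h)\<in>L \<times> carrier G. B (k, h') (l, h) * v ((i, l), h)))"
      using right_conv_commute[OF B fin(1,4), where D = "\<lambda>g. D (j, g)"
          and v = "\<lambda>i l h. v ((i, l), h)"] D_translate that by (simp add: w_def)
    also have "\<dots> = (\<Sum>(i, h')\<in>I \<times> carrier G. D (j, g) (i, h') *
          (\<Sum>(j', h)\<in>J \<times> carrier G. M (i, h') (j', h) * (\<lambda>(j', h). u ((j', k), h)) (j', h)))"
      using cycle that by (intro sum.cong) auto
    also have "\<dots> = u ((j, k), g)"
      using D_inverse[OF uS, of j g k] that by simp
    finally show ?thesis .
  qed

  \<comment> \<open>For fixed \<open>i\<close>, the error M w - v is a word on \<open>L\<close> and
    the group; it is killed by \<open>B\<close> and supported in \<open>T\<close>, hence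
    zero.\<close>
  have Mw: "(\<Sum>(j, h)\<in>J \<times> carrier G. M (i, g) (j, h) * w ((j, l), h)) = v ((i, l), g)"
    if i: "i \<in> I" and "l \<in> L" "g \<in> carrier G" for i l g
  proof -
    define z where "z = (\<lambda>(l, g). if l \<in> L \<and> g \<in> carrier G then
      (\<Sum>(j, h)\<in>J \<times> carrier G. M (i, g) (j, h) * w ((j, l), h)) - v ((i, l), g) else 0)"
    have "z = (\<lambda>_. 0)"
    proof (rule trivB)
      have "(\<Sum>(l, h)\<in>L \<times> carrier G. B (k, g) (l, h) * z (l, h)) = 0"
        if k: "k \<in> K" and g: "g \<in> carrier G" for k g
      proof -
        have "(\<Sum>(l, h)\<in>L \<times> carrier G. B (k, g) (l, h) * z (l, h)) =
           (\<Sum>(l, h)\<in>L \<times> carrier G. B (k, g) (l, h) *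
             (\<Sum>(j, h')\<in>J \<times> carrier G. M (i, h) (j, h') * w ((j, l), h')))
           - (\<Sum>(l, h)\<in>L \<times> carrier G. B (k, g) (l, h) * v ((i, l), h))"
          unfolding sum_subtractf[symmetric]
          by (intro sum.cong refl) (auto simp: z_def right_diff_distrib)
        \<comment> \<open>\<open>M\<close> is itself invariant under right translations, so it
          commutes with \<open>B\<close> just as \<open>D\<close> does: B M w = M B w = M u = B
          v.\<close>
        also have "(\<Sum>(l, h)\<in>L \<times> carrier G. B (k, g) (l, h) *
             (\<Sum>(j, h')\<in>J \<times> carrier G. M (i, h) (j, h') * w ((j, l), h'))) =
           (\<Sum>(j, h')\<in>J \<times> carrier G. M (i, g) (j, h') *
             (\<Sum>(l, h)\<in>L \<times> carrier G. B (k, h') (l, h) * w ((j, l), h)))"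
          using right_conv_commute[OF B fin(2,4), where D = "\<lambda>g. M (i, g)"
            and v = "\<lambda>j l h. w ((j, l), h)"] left_conv_translate[OF M i] k g by simp
        also have "\<dots> = (\<Sum>(j, h')\<in>J \<times> carrier G. M (i, g) (j, h') * u ((j, k), h'))"
          using Bw k by (intro sum.cong) auto
        finally show ?thesis using cycle[OF i k g] by simp
      qed
      moreover have "z c = 0" if "c \<notin> L \<times> carrier G" for c
        using that by (auto simp: z_def split: prod.splits)
      ultimately show "z \<in> ker_code (K \<times> carrier G) (L \<times> carrier G) B"
        by (auto simp: ker_code_def case_prod_unfold)
      show "{c. z c \<noteq> 0} \<subseteq> T"
      proof clarify
        fix l g assume "z (l, g) \<noteq> 0"
        then have lg: "l \<in> L" "g \<in> carrier G"
          and nz: "(\<Sum>(j, h)\<in>J \<times> carrier G. M (i, g) (j, h) * w ((j, l), h)) \<noteq> 0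
            \<or> v ((i, l), g) \<noteq> 0"
          by (auto simp: z_def split: if_splits)
        from nz show "(l, g) \<in> T"
        proof
          assume "v ((i, l), g) \<noteq> 0"
          then show ?thesis using vT[of i] by auto
        next
          assume "(\<Sum>(j, h)\<in>J \<times> carrier G. M (i, g) (j, h) * w ((j, l), h)) \<noteq> 0"
          then obtain j h where h: "j \<in> J" "h \<in> carrier G" "M (i, g) (j, h) \<noteq> 0" "w ((j, l), h) \<noteq> 0"
            by (auto elim: sum.not_neutral_contains_not_neutral)
          then have "(\<Sum>(i', h')\<in>I \<times> carrier G. D (j, h) (i', h') * v ((i', l), h')) \<noteq> 0"
            by (simp add: w_def)
          then obtain i' h' where h': "h' \<in> carrier G" "D (j, h) (i', h') \<noteq> 0" "v ((i', l), h') \<noteq> 0"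
            by (rule sum.not_neutral_contains_not_neutral) auto
          \<comment> \<open>\<open>M\<close> and \<open>D\<close> both stay inside right cosets of
            \<open>P\<close>, so \<open>g\<close> differs from a support point \<open>h'\<close> of
            \<open>v\<close> by a left factor from \<open>P\<close>. This is what \<open>T\<close>
            allows.\<close>
          have "h \<otimes> inv g \<in> P" using left_conv_eq_0[OF M i] h lg by blast
          then have "(h' \<otimes> inv h) \<otimes> (h \<otimes> inv g) \<in> P" using D_P[OF h'(2)] by simp
          moreover have "(h' \<otimes> inv h) \<otimes> (h \<otimes> inv g) \<otimes> g = h'"
            using h h' lg by (simp add: m_assoc flip: m_assoc[of "inv h"])
          ultimately show ?thesis using lg h'(3) unfolding T_def
            by (auto intro!: bexI[of _ "(h' \<otimes> inv h) \<otimes> (h \<otimes> inv g)"])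
        qed
      qed
    qed
    then have "z (l, g) = 0" by simp
    then show ?thesis using that by (simp add: z_def)
  qed
  show ?thesis by (intro exI[of _ w] conjI ballI) (simp_all add: Bw Mw)
qed

end

section \<open>Convolution form of the check matrices\<close>

text \<open>In the convolution sum only the factorisation of \<open>g\<close> with second factor
  \<open>h\<close> survives.\<close>

lemma (in group) ga_mult_basis_right:
  assumes "finite (carrier G)" "g \<in> carrier G" "h \<in> carrier G"
  shows "ga_mult G a (ga_basis h) g = a (g \<otimes> inv h)"
proof -
  have "ga_mult G a (ga_basis h) g = (\<Sum>(x, y)\<in>{(g \<otimes> inv h, h)}. a x * ga_basis h y)"
    unfolding ga_mult_def
  proof (rule sum.mono_neutral_right)
    show "finite {(x, y) \<in> carrier G \<times> carrier G. x \<otimes> y = g}"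
      by (rule finite_subset[of _ "carrier G \<times> carrier G"]) (use assms in auto)
    show "{(g \<otimes> inv h, h)} \<subseteq> {(x, y) \<in> carrier G \<times> carrier G. x \<otimes> y = g}"
      using assms by (auto simp: m_assoc)
    show "\<forall>c\<in>{(x, y) \<in> carrier G \<times> carrier G. x \<otimes> y = g} - {(g \<otimes> inv h, h)}.
        (case c of (x, y) \<Rightarrow> a x * ga_basis h y) = 0"
      using assms by (auto simp: ga_basis_def m_assoc split: if_splits)
  qed
  then show ?thesis by (simp add: ga_basis_def)
qed

lemma (in group) ga_mult_basis_left:
  assumes "finite (carrier G)" "g \<in> carrier G" "h \<in> carrier G"
  shows "ga_mult G (ga_basis h) a g = a (inv h \<otimes> g)"
proof -
  have "ga_mult G (ga_basis h) a g = (\<Sum>(x, y)\<in>{(h, inv h \<otimes> g)}. ga_basis h x * a y)"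
    unfolding ga_mult_def
  proof (rule sum.mono_neutral_right)
    show "finite {(x, y) \<in> carrier G \<times> carrier G. x \<otimes> y = g}"
      by (rule finite_subset[of _ "carrier G \<times> carrier G"]) (use assms in auto)
    show "{(h, inv h \<otimes> g)} \<subseteq> {(x, y) \<in> carrier G \<times> carrier G. x \<otimes> y = g}"
      using assms by (auto simp flip: m_assoc)
    show "\<forall>c\<in>{(x, y) \<in> carrier G \<times> carrier G. x \<otimes> y = g} - {(h, inv h \<otimes> g)}.
        (case c of (x, y) \<Rightarrow> ga_basis h x * a y) = 0"
      using assms by (auto simp: ga_basis_def simp flip: m_assoc split: if_splits)
  qed
  then show ?thesis by (simp add: ga_basis_def)
qed

text \<open>Left multiplication has entry a(g h^-1) at row g and column h; the transpose in
  \<open>left_nat\<close> exchanges the two, which gives h g^-1.\<close>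

lemma (in group) left_nat_eq:
  "finite (carrier G) \<Longrightarrow> g \<in> carrier G \<Longrightarrow> h \<in> carrier G \<Longrightarrow>
    left_nat G A (i, g) (j, h) = (A $$ (i, j)) (h \<otimes> inv g)"
  by (simp add: left_nat_def mtx_transpose_def left_reg_def ga_mult_basis_right)

lemma (in group) right_nat_eq:
  "finite (carrier G) \<Longrightarrow> g \<in> carrier G \<Longrightarrow> h \<in> carrier G \<Longrightarrow>
    right_nat G B (i, g) (j, h) = (B $$ (i, j)) (inv h \<otimes> g)"
  by (simp add: right_nat_def right_reg_def ga_mult_basis_left)

text \<open>The entry formula involves only products and inverses, which agree in \<open>H\<close>
  and \<open>G\<close>. So the matrix over the subgroup is a submatrix of the one over the
  group.\<close>

lemma (in group) left_nat_subgroup: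
  assumes "finite (carrier G)" "subgroup H G" "g \<in> H" "h \<in> H"
  shows "left_nat (G\<lparr>carrier := H\<rparr>) A (i, g) (j, h) = left_nat G A (i, g) (j, h)"
proof -
  interpret H: subgroup H G by fact
  interpret K: group "G\<lparr>carrier := H\<rparr>" by (rule H.subgroup_is_group) (rule is_group)
  show ?thesis
    using assms K.left_nat_eq[of g h A i j] finite_subset[OF H.subset] by (simp add: left_nat_eq)
qed

lemma (in group) right_nat_subgroup:
  assumes "finite (carrier G)" "subgroup H G" "g \<in> H" "h \<in> H"
  shows "right_nat (G\<lparr>carrier := H\<rparr>) A (i, g) (j, h) = right_nat G A (i, g) (j, h)"
proof -
  interpret H: subgroup H G by fact
  interpret K: group "G\<lparr>carrier := H\<rparr>" by (rule H.subgroup_is_group) (rule is_group)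
  show ?thesis
    using assms K.right_nat_eq[of g h A i j] finite_subset[OF H.subset] by (simp add: right_nat_eq)
qed

section \<open>Kernels and Kronecker products with an identity factor\<close>

lemma ker_code_cong:
  "(\<And>r c. r \<in> R \<Longrightarrow> c \<in> C \<Longrightarrow> H r c = H' r c) \<Longrightarrow> ker_code R C H = ker_code R C H'"
  by (simp add: ker_code_def)

text \<open>Collapses the Kronecker delta that an identity factor leaves in a sum over qudits or
  checks: on the second block index in the first part, on the first in the second.\<close>

lemma sum_product_delta:
  fixes f :: "'x \<Rightarrow> 'y \<Rightarrow> 'z \<Rightarrow> 'f::comm_semiring_0"
  assumes "finite X" "finite Y"
  shows "y \<in> Y \<Longrightarrow> (\<Sum>((x, y'), z)\<in>(X \<times> Y) \<times> Z. if y = y' then f x y' z else 0) = (\<Sum>(x, z)\<in>X \<times> Z. f x y z)"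
    and "x \<in> X \<Longrightarrow> (\<Sum>((x', y), z)\<in>(X \<times> Y) \<times> Z. if x = x' then f x' y z else 0) = (\<Sum>(y, z)\<in>Y \<times> Z. f x y z)"
proof -
  assume "y \<in> Y"
  have "(\<Sum>((x, y'), z)\<in>(X \<times> Y) \<times> Z. if y = y' then f x y' z else 0) =
      (\<Sum>x\<in>X. \<Sum>y'\<in>Y. \<Sum>z\<in>Z. if y = y' then f x y' z else 0)"
    by (simp add: sum.cartesian_product')
  also have "\<dots> = (\<Sum>x\<in>X. \<Sum>y'\<in>Y. if y = y' then \<Sum>z\<in>Z. f x y' z else 0)"
    by (intro sum.cong refl) auto
  also have "\<dots> = (\<Sum>(x, z)\<in>X \<times> Z. f x y z)"
    using assms \<open>y \<in> Y\<close> by (simp add: sum.cartesian_product)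
  finally show "(\<Sum>((x, y'), z)\<in>(X \<times> Y) \<times> Z. if y = y' then f x y' z else 0) = (\<Sum>(x, z)\<in>X \<times> Z. f x y z)" .
next
  assume "x \<in> X"
  have "(\<Sum>((x', y), z)\<in>(X \<times> Y) \<times> Z. if x = x' then f x' y z else 0) =
      (\<Sum>x'\<in>X. \<Sum>y\<in>Y. \<Sum>z\<in>Z. if x = x' then f x' y z else 0)"
    by (simp add: sum.cartesian_product')
  also have "\<dots> = (\<Sum>x'\<in>X. if x = x' then \<Sum>y\<in>Y. \<Sum>z\<in>Z. f x' y z else 0)"
    by (intro sum.cong refl) auto
  also have "\<dots> = (\<Sum>(y, z)\<in>Y \<times> Z. f x y z)"
    using assms \<open>x \<in> X\<close> by (simp add: sum.cartesian_product)
  finally show "(\<Sum>((x', y), z)\<in>(X \<times> Y) \<times> Z. if x = x' then f x' y z else 0) = (\<Sum>(y, z)\<in>Y \<times> Z. f x y z)" .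
qed

lemma block_kron_id_right:
  assumes "finite S" "h \<in> S"
  shows "block_kron S M id_matrix ((i, k), g) ((j, l), h) = (if k = l then M (i, g) (j, h) else 0)"
  using assms by (simp add: block_kron_def id_matrix_def if_distrib cong: if_cong)

lemma block_kron_id_left:
  assumes "finite S" "g \<in> S"
  shows "block_kron S id_matrix N ((i, k), g) ((j, l), h) = (if i = j then N (k, g) (l, h) else 0)"
  using assms by (simp add: block_kron_def id_matrix_def if_distrib[of "\<lambda>x. x * _"] cong: if_cong)

lemma block_kron_neg_left: "block_kron S (neg_matrix M) N r c = - block_kron S M N r c"
  by (simp add: block_kron_def neg_matrix_def sum_negf split: prod.splits)

context
  fixes G :: "('g, 'b) monoid_scheme" and A B :: "('g \<Rightarrow> 'f::field) mat"
  assumes fin: "finite (carrier G)"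
begin

section \<open>The check matrices and their transposes acting on words\<close>

lemma lp_HX_entry:
  assumes "g \<in> carrier G" "h \<in> carrier G"
  shows "lp_HX G A B ((i, k), g) (Inl ((j, l), h)) = (if k = l then left_nat G A (i, g) (j, h) else 0)"
    and "lp_HX G A B ((i, k), g) (Inr ((j, l), h)) = (if i = j then - right_nat G B (k, g) (l, h) else 0)"
  using assms fin
  by (simp_all add: lp_HX_def hcat_def block_kron_id_right block_kron_neg_left block_kron_id_left)

lemma lp_HZ_entry:
  assumes "g \<in> carrier G" "h \<in> carrier G"
  shows "lp_HZ G A B ((i, k), g) (Inl ((j, l), h)) = (if i = j then right_nat G B (l, h) (k, g) else 0)"
    and "lp_HZ G A B ((i, k), g) (Inr ((j, l), h)) = (if k = l then left_nat G A (j, h) (i, g) else 0)"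
  using assms fin
  by (simp_all add: lp_HZ_def hcat_def block_kron_id_right block_kron_id_left mtx_transpose_def)

text \<open>Puts a parity check into the form of the cycle equation: left convolution by
  \<open>A\<close> on the first half of the word against right convolution by \<open>B\<close> on
  the second.\<close>

lemma lp_HX_mult:
  assumes "i < dim_row A" "k < dim_row B" "g \<in> carrier G"
  shows "(\<Sum>c\<in>lp_qudits G A B. lp_HX G A B ((i, k), g) c * x c) =
    (\<Sum>(j, h)\<in>{..<dim_col A} \<times> carrier G. left_nat G A (i, g) (j, h) * x (Inl ((j, k), h))) -
    (\<Sum>(l, h)\<in>{..<dim_col B} \<times> carrier G. right_nat G B (k, g) (l, h) * x (Inr ((i, l), h)))"
proof -
  have "(\<Sum>c\<in>({..<dim_col A} \<times> {..<dim_row B}) \<times> carrier G. lp_HX G A B ((i, k), g) (Inl c) * x (Inl c))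
    = (\<Sum>((j, l), h)\<in>({..<dim_col A} \<times> {..<dim_row B}) \<times> carrier G.
        if k = l then left_nat G A (i, g) (j, h) * x (Inl ((j, l), h)) else 0)" (is "?L = _")
    using assms by (intro sum.cong refl) (auto simp: lp_HX_entry)
  also have "\<dots> = (\<Sum>(j, h)\<in>{..<dim_col A} \<times> carrier G. left_nat G A (i, g) (j, h) * x (Inl ((j, k), h)))"
    using assms by (intro sum_product_delta(1)) auto
  finally have L: "?L = (\<Sum>(j, h)\<in>{..<dim_col A} \<times> carrier G. left_nat G A (i, g) (j, h) * x (Inl ((j, k), h)))" .
  have "(\<Sum>c\<in>({..<dim_row A} \<times> {..<dim_col B}) \<times> carrier G. lp_HX G A B ((i, k), g) (Inr c) * x (Inr c))
    = (\<Sum>((j, l), h)\<in>({..<dim_row A} \<times> {..<dim_col B}) \<times> carrier G.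
        if i = j then - (right_nat G B (k, g) (l, h) * x (Inr ((j, l), h))) else 0)" (is "?R = _")
    using assms by (intro sum.cong refl) (auto simp: lp_HX_entry)
  also have "\<dots> = (\<Sum>(l, h)\<in>{..<dim_col B} \<times> carrier G. - (right_nat G B (k, g) (l, h) * x (Inr ((i, l), h))))"
    using assms by (intro sum_product_delta(2)) auto
  finally have R: "?R = (\<Sum>(l, h)\<in>{..<dim_col B} \<times> carrier G. - (right_nat G B (k, g) (l, h) * x (Inr ((i, l), h))))" .
  show ?thesis
    using fin by (simp add: lp_qudits_def sum.Plus L R) (simp add: sum_negf case_prod_unfold)
qed

lemma lp_HZ_mult:
  assumes "j < dim_col A" "l < dim_col B" "g \<in> carrier G"
  shows "(\<Sum>c\<in>lp_qudits G A B. lp_HZ G A B ((j, l), g) c * x c) =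
    (\<Sum>(k, h)\<in>{..<dim_row B} \<times> carrier G. right_nat G B (k, h) (l, g) * x (Inl ((j, k), h))) +
    (\<Sum>(i, h)\<in>{..<dim_row A} \<times> carrier G. left_nat G A (i, h) (j, g) * x (Inr ((i, l), h)))"
proof -
  have "(\<Sum>c\<in>({..<dim_col A} \<times> {..<dim_row B}) \<times> carrier G. lp_HZ G A B ((j, l), g) (Inl c) * x (Inl c))
    = (\<Sum>((j', k), h)\<in>({..<dim_col A} \<times> {..<dim_row B}) \<times> carrier G.
        if j = j' then right_nat G B (k, h) (l, g) * x (Inl ((j', k), h)) else 0)" (is "?L = _")
    using assms by (intro sum.cong refl) (auto simp: lp_HZ_entry)
  also have "\<dots> = (\<Sum>(k, h)\<in>{..<dim_row B} \<times> carrier G. right_nat G B (k, h) (l, g) * x (Inl ((j, k), h)))"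
    using assms by (intro sum_product_delta(2)) auto
  finally have L: "?L = (\<Sum>(k, h)\<in>{..<dim_row B} \<times> carrier G. right_nat G B (k, h) (l, g) * x (Inl ((j, k), h)))" .
  have "(\<Sum>c\<in>({..<dim_row A} \<times> {..<dim_col B}) \<times> carrier G. lp_HZ G A B ((j, l), g) (Inr c) * x (Inr c))
    = (\<Sum>((i, l'), h)\<in>({..<dim_row A} \<times> {..<dim_col B}) \<times> carrier G.
        if l = l' then left_nat G A (i, h) (j, g) * x (Inr ((i, l'), h)) else 0)" (is "?R = _")
    using assms by (intro sum.cong refl) (auto simp: lp_HZ_entry)
  also have "\<dots> = (\<Sum>(i, h)\<in>{..<dim_row A} \<times> carrier G. left_nat G A (i, h) (j, g) * x (Inr ((i, l), h)))"
    using assms by (intro sum_product_delta(1)) auto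
  finally have R: "?R = (\<Sum>(i, h)\<in>{..<dim_row A} \<times> carrier G. left_nat G A (i, h) (j, g) * x (Inr ((i, l), h)))" .
  show ?thesis
    using fin by (simp add: lp_qudits_def sum.Plus L R)
qed

text \<open>This and the next three lemmas compute combinations of rows on either half of the
  qudits, so that a boundary can be recognised as a member of the dual code.\<close>

lemma lp_HX_transpose_mult_Inl:
  assumes "j < dim_col A" "k < dim_row B" "h \<in> carrier G"
  shows "(\<Sum>r\<in>lp_X_checks G A B. lp_HX G A B r (Inl ((j, k), h)) * w r) =
    (\<Sum>(i, g)\<in>{..<dim_row A} \<times> carrier G. left_nat G A (i, g) (j, h) * w ((i, k), g))"
proof -
  have "(\<Sum>r\<in>lp_X_checks G A B. lp_HX G A B r (Inl ((j, k), h)) * w r) =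
      (\<Sum>((i, k'), g)\<in>({..<dim_row A} \<times> {..<dim_row B}) \<times> carrier G.
        if k = k' then left_nat G A (i, g) (j, h) * w ((i, k'), g) else 0)"
    unfolding lp_X_checks_def using assms by (intro sum.cong refl) (auto simp: lp_HX_entry)
  also have "\<dots> = (\<Sum>(i, g)\<in>{..<dim_row A} \<times> carrier G. left_nat G A (i, g) (j, h) * w ((i, k), g))"
    using assms by (intro sum_product_delta(1)) auto
  finally show ?thesis .
qed

lemma lp_HX_transpose_mult_Inr:
  assumes "i < dim_row A" "l < dim_col B" "h \<in> carrier G"
  shows "(\<Sum>r\<in>lp_X_checks G A B. lp_HX G A B r (Inr ((i, l), h)) * w r) =
    - (\<Sum>(k, g)\<in>{..<dim_row B} \<times> carrier G. right_nat G B (k, g) (l, h) * w ((i, k), g))"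
proof -
  have "(\<Sum>r\<in>lp_X_checks G A B. lp_HX G A B r (Inr ((i, l), h)) * w r) =
      (\<Sum>((i', k), g)\<in>({..<dim_row A} \<times> {..<dim_row B}) \<times> carrier G.
        if i = i' then - (right_nat G B (k, g) (l, h) * w ((i', k), g)) else 0)"
    unfolding lp_X_checks_def using assms by (intro sum.cong refl) (auto simp: lp_HX_entry)
  also have "\<dots> = (\<Sum>(k, g)\<in>{..<dim_row B} \<times> carrier G. - (right_nat G B (k, g) (l, h) * w ((i, k), g)))"
    using assms by (intro sum_product_delta(2)) auto
  finally show ?thesis by (simp add: sum_negf case_prod_unfold)
qed

lemma lp_HZ_transpose_mult_Inl:
  assumes "j < dim_col A" "k < dim_row B" "h \<in> carrier G"
  shows "(\<Sum>r\<in>lp_Z_checks G A B. lp_HZ G A B r (Inl ((j, k), h)) * w r) =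
    (\<Sum>(l, g)\<in>{..<dim_col B} \<times> carrier G. right_nat G B (k, h) (l, g) * w ((j, l), g))"
proof -
  have "(\<Sum>r\<in>lp_Z_checks G A B. lp_HZ G A B r (Inl ((j, k), h)) * w r) =
      (\<Sum>((j', l), g)\<in>({..<dim_col A} \<times> {..<dim_col B}) \<times> carrier G.
        if j = j' then right_nat G B (k, h) (l, g) * w ((j', l), g) else 0)"
    unfolding lp_Z_checks_def using assms by (intro sum.cong refl) (auto simp: lp_HZ_entry)
  also have "\<dots> = (\<Sum>(l, g)\<in>{..<dim_col B} \<times> carrier G. right_nat G B (k, h) (l, g) * w ((j, l), g))"
    using assms by (intro sum_product_delta(2)) auto
  finally show ?thesis .
qed

lemma lp_HZ_transpose_mult_Inr:
  assumes "i < dim_row A" "l < dim_col B" "h \<in> carrier G"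
  shows "(\<Sum>r\<in>lp_Z_checks G A B. lp_HZ G A B r (Inr ((i, l), h)) * w r) =
    (\<Sum>(j, g)\<in>{..<dim_col A} \<times> carrier G. left_nat G A (i, h) (j, g) * w ((j, l), g))"
proof -
  have "(\<Sum>r\<in>lp_Z_checks G A B. lp_HZ G A B r (Inr ((i, l), h)) * w r) =
      (\<Sum>((j, l'), g)\<in>({..<dim_col A} \<times> {..<dim_col B}) \<times> carrier G.
        if l = l' then left_nat G A (i, h) (j, g) * w ((j, l'), g) else 0)"
    unfolding lp_Z_checks_def using assms by (intro sum.cong refl) (auto simp: lp_HZ_entry)
  also have "\<dots> = (\<Sum>(j, g)\<in>{..<dim_col A} \<times> carrier G. left_nat G A (i, h) (j, g) * w ((j, l), g))"
    using assms by (intro sum_product_delta(1)) auto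
  finally show ?thesis .
qed

lemma finite_lp_qudits: "finite (lp_qudits G A B)"
  using fin by (simp add: lp_qudits_def)

end

section \<open>The distance bound\<close>

text \<open>Used contrapositively: a weight below the floor of \<open>d / k\<close> stays below
  \<open>d\<close> after multiplication by \<open>k\<close>.\<close>

lemma enat_floor_div_le:
  assumes "d \<le> enat (a * k)" "k > 0"
  shows "enat_floor_div d k \<le> enat a"
proof -
  from assms(1) obtain m where m: "d = enat m" "m \<le> a * k" by (cases d) auto
  then have "m div k \<le> (a * k) div k" by (intro div_le_mono)
  then show ?thesis using assms(2) m by (simp add: enat_floor_div_def)
qed

lemma min_distance_le: "x \<in> K \<Longrightarrow> x \<noteq> (\<lambda>_. 0) \<Longrightarrow> min_distance K \<le> enat (hamming_weight x)"
  unfolding min_distance_def min_weight_def by (rule INF_lower) simp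

lemma hamming_weight_uminus: "hamming_weight (\<lambda>x. - u x) = hamming_weight u"
  by (simp add: hamming_weight_def)

text \<open>Applied to the two injections of a sum type: neither half of a word weighs more than the
  whole.\<close>

lemma hamming_weight_comp_le:
  assumes "finite {c. x c \<noteq> 0}" "inj f"
  shows "hamming_weight (\<lambda>a. x (f a)) \<le> hamming_weight x"
  unfolding hamming_weight_def
  by (rule card_inj_on_le[of f]) (use assms in \<open>auto intro: inj_on_subset\<close>)

context factorised_group
begin

lemma left_conv_left_nat:
  assumes "elements_mat A \<subseteq> group_algebra P"
  shows "left_conv {..<dim_row A} {..<dim_col A} (left_nat G A)"
  unfolding left_conv_def
proof (intro ballI conjI impI)
  fix i j g h x
  assume "i \<in> {..<dim_row A}" "j \<in> {..<dim_col A}" and g: "g \<in> carrier G" "h \<in> carrier G"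
  then have "A $$ (i, j) \<in> group_algebra P" using assms by blast
  then show "h \<otimes> inv g \<in> P" if "left_nat G A (i, g) (j, h) \<noteq> 0"
    using that g finite_carrier by (auto simp: left_nat_eq group_algebra_def)
  assume x: "x \<in> carrier G"
  have "h \<otimes> x \<otimes> inv (g \<otimes> x) = h \<otimes> inv g"
    using g x by (simp add: inv_mult_group m_assoc flip: m_assoc[of x])
  then show "left_nat G A (i, g \<otimes> x) (j, h \<otimes> x) = left_nat G A (i, g) (j, h)"
    using g x finite_carrier by (simp add: left_nat_eq)
qed

lemma right_conv_right_nat:
  assumes "elements_mat B \<subseteq> group_algebra Q"
  shows "right_conv {..<dim_row B} {..<dim_col B} (right_nat G B)"
  unfolding right_conv_def
proof (intro ballI conjI impI)
  fix i j g h x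
  assume "i \<in> {..<dim_row B}" "j \<in> {..<dim_col B}" and g: "g \<in> carrier G" "h \<in> carrier G"
  then have "B $$ (i, j) \<in> group_algebra Q" using assms by blast
  then show "inv h \<otimes> g \<in> Q" if "right_nat G B (i, g) (j, h) \<noteq> 0"
    using that g finite_carrier by (auto simp: right_nat_eq group_algebra_def)
  assume x: "x \<in> carrier G"
  have "inv (x \<otimes> h) \<otimes> (x \<otimes> g) = inv h \<otimes> g"
    using g x by (simp add: inv_mult_group m_assoc flip: m_assoc[of "inv x"])
  then show "right_nat G B (i, x \<otimes> g) (j, x \<otimes> h) = right_nat G B (i, g) (j, h)"
    using g x finite_carrier by (simp add: right_nat_eq)
qed

text \<open>Expresses the code over the subgroup by the matrix over the whole group, the form in
  which the low-weight argument asks for its distance assumptions.\<close>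

lemma left_code_subgroup:
  "left_code (G\<lparr>carrier := P\<rparr>) A = ker_code ({..<dim_row A} \<times> P) ({..<dim_col A} \<times> P) (left_nat G A)"
  unfolding left_code_def block_rows_def block_cols_def
  by (simp, rule ker_code_cong)
    (auto simp: left_nat_subgroup[OF finite_carrier subgroup_P])

lemma left_code_transp_subgroup:
  "left_code_transp (G\<lparr>carrier := P\<rparr>) A =
    ker_code ({..<dim_col A} \<times> P) ({..<dim_row A} \<times> P) (mtx_transpose (left_nat G A))"
  unfolding left_code_transp_def block_rows_def block_cols_def
  by (simp, rule ker_code_cong)
    (auto simp: mtx_transpose_def left_nat_subgroup[OF finite_carrier subgroup_P])

lemma right_code_subgroup:
  "right_code (G\<lparr>carrier := Q\<rparr>) B = ker_code ({..<dim_row B} \<times> Q) ({..<dim_col B} \<times> Q) (right_nat G B)"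
  unfolding right_code_def block_rows_def block_cols_def
  by (simp, rule ker_code_cong)
    (auto simp: right_nat_subgroup[OF finite_carrier subgroup_Q])

lemma right_code_transp_subgroup:
  "right_code_transp (G\<lparr>carrier := Q\<rparr>) B =
    ker_code ({..<dim_col B} \<times> Q) ({..<dim_row B} \<times> Q) (mtx_transpose (right_nat G B))"
  unfolding right_code_transp_def block_rows_def block_cols_def
  by (simp, rule ker_code_cong)
    (auto simp: mtx_transpose_def right_nat_subgroup[OF finite_carrier subgroup_Q])

text \<open>A codeword of weight below the bound is a low-weight cycle, hence a boundary, hence in
  the dual code. The X side uses \<open>A\<close> and \<open>B\<close>, the Z side their transposes
  with the two halves of the word exchanged.\<close>

theorem lp_distance_ge:
  fixes A B :: "('a \<Rightarrow> 'f::field) mat"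
  assumes A: "elements_mat A \<subseteq> group_algebra P" and B: "elements_mat B \<subseteq> group_algebra Q"
    and Q0: "of_nat (card Q) \<noteq> (0 :: 'f)"
    and d: "d \<le> min_distance (left_code (G\<lparr>carrier := P\<rparr>) A)"
      "d \<le> min_distance (right_code (G\<lparr>carrier := Q\<rparr>) B)"
      "d \<le> min_distance (left_code_transp (G\<lparr>carrier := P\<rparr>) A)"
      "d \<le> min_distance (right_code_transp (G\<lparr>carrier := Q\<rparr>) B)"
  shows "enat_floor_div d (card (P \<inter> Q)) \<le> lp_distance G A B"
proof -
  have N0: "card (P \<inter> Q) > 0"
    using finite_subset[OF P.subset finite_carrier] P.one_closed Q.one_closed
    by (subst card_gt_0_iff) blast
  \<comment> \<open>Supplies the distance assumptions of the low-weight argument: if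
    \<open>c\<close> is below the bound, the weight of either half times |P \<inter> Q| is less than
    \<open>d\<close>.\<close>
  have trivial: "x = (\<lambda>_. 0)"
    if "\<not> enat_floor_div d (card (P \<inter> Q)) \<le> enat (hamming_weight c)"
      and "d \<le> min_distance K" "x \<in> K" and "hamming_weight x \<le> hamming_weight u * card (P \<inter> Q)"
      and "hamming_weight u \<le> hamming_weight c"
    for c :: "'a lp_qudit \<Rightarrow> 'f" and K and x :: "nat \<times> 'a \<Rightarrow> 'f"
      and u :: "(nat \<times> nat) \<times> 'a \<Rightarrow> 'f"
  proof (rule ccontr)
    assume "x \<noteq> (\<lambda>_. 0)"
    then have "d \<le> enat (hamming_weight x)"
      using min_distance_le that(2,3) order_trans by blast
    also have "hamming_weight x \<le> hamming_weight c * card (P \<inter> Q)"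
      using that(4,5) by (meson mult_le_mono1 order_trans)
    finally show False using enat_floor_div_le N0 that(1) by simp
  qed
  have "enat_floor_div d (card (P \<inter> Q)) \<le> enat (hamming_weight c)"
    if c: "c \<in> lp_CX G A B - dual_code (lp_qudits G A B) (lp_CZ G A B)" for c
  proof (rule ccontr)
    assume low: "\<not> ?thesis"
    have c0: "c a = 0" if "a \<notin> lp_qudits G A B" for a
      using c that by (auto simp: lp_CX_def ker_code_def)
    have supp: "a \<in> lp_qudits G A B" if "c a \<noteq> 0" for a
      using c0 that by blast
    have fc: "finite {a. c a \<noteq> 0}"
      using supp by (auto intro: finite_subset[OF _ finite_lp_qudits[OF finite_carrier]])
    define u where "u = (\<lambda>a. c (Inl a))"
    define v where "v = (\<lambda>a. c (Inr a))"
    have hw: "hamming_weight u \<le> hamming_weight c" "hamming_weight v \<le> hamming_weight c"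
      unfolding u_def v_def by (rule hamming_weight_comp_le[OF fc], simp)+
    have supp_u: "{a. u a \<noteq> 0} \<subseteq> ({..<dim_col A} \<times> {..<dim_row B}) \<times> carrier G"
      by (auto simp: u_def dest!: supp[unfolded lp_qudits_def])
    have supp_v: "{a. v a \<noteq> 0} \<subseteq> ({..<dim_row A} \<times> {..<dim_col B}) \<times> carrier G"
      by (auto simp: v_def dest!: supp[unfolded lp_qudits_def])
    have cycle: "(\<Sum>(j, h)\<in>{..<dim_col A} \<times> carrier G. left_nat G A (i, g) (j, h) * u ((j, k), h)) =
      (\<Sum>(l, h)\<in>{..<dim_col B} \<times> carrier G. right_nat G B (k, g) (l, h) * v ((i, l), h))"
      if "i \<in> {..<dim_row A}" "k \<in> {..<dim_row B}" "g \<in> carrier G" for i k g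
    proof -
      have "(\<Sum>a\<in>lp_qudits G A B. lp_HX G A B ((i, k), g) a * c a) = 0"
        using c that by (auto simp: lp_CX_def ker_code_def lp_X_checks_def)
      then show ?thesis
        using lp_HX_mult[OF finite_carrier, of i A k B g c] that by (simp add: u_def v_def)
    qed
    have "\<exists>w. (\<forall>j\<in>{..<dim_col A}. \<forall>k\<in>{..<dim_row B}. \<forall>g\<in>carrier G.
        u ((j, k), g) = (\<Sum>(l, h)\<in>{..<dim_col B} \<times> carrier G. right_nat G B (k, g) (l, h) * w ((j, l), h))) \<and>
      (\<forall>i\<in>{..<dim_row A}. \<forall>l\<in>{..<dim_col B}. \<forall>g\<in>carrier G.
        v ((i, l), g) = (\<Sum>(j, h)\<in>{..<dim_col A} \<times> carrier G. left_nat G A (i, g) (j, h) * w ((j, l), h)))"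
      by (rule low_weight_cycle_is_boundary[OF left_conv_left_nat[OF A] right_conv_right_nat[OF B]
          finite_lessThan finite_lessThan finite_lessThan finite_lessThan Q0 supp_u supp_v cycle
          trivial[OF low d(1) _ _ hw(1), unfolded left_code_subgroup]
          trivial[OF low d(2) _ _ hw(2), unfolded right_code_subgroup]])
    then obtain w where "\<And>j k g. j < dim_col A \<Longrightarrow> k < dim_row B \<Longrightarrow> g \<in> carrier G \<Longrightarrow>
        c (Inl ((j, k), g)) = (\<Sum>(l, h)\<in>{..<dim_col B} \<times> carrier G. right_nat G B (k, g) (l, h) * w ((j, l), h))"
      "\<And>i l g. i < dim_row A \<Longrightarrow> l < dim_col B \<Longrightarrow> g \<in> carrier G \<Longrightarrow>
        c (Inr ((i, l), g)) = (\<Sum>(j, h)\<in>{..<dim_col A} \<times> carrier G. left_nat G A (i, g) (j, h) * w ((j, l), h))"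
      unfolding u_def v_def by blast
    \<comment> \<open>The two boundary equations say that \<open>c\<close> is the combination of the
      rows of \<open>lp_HZ\<close> with coefficients \<open>w\<close>.\<close>
    then have "c \<in> dual_code (lp_qudits G A B) (lp_CZ G A B)"
      unfolding lp_CZ_def
      by (intro row_combination_in_dual_code[where w = w] finite_lp_qudits[OF finite_carrier] c0)
        (auto simp: lp_qudits_def lp_HZ_transpose_mult_Inl[OF finite_carrier]
          lp_HZ_transpose_mult_Inr[OF finite_carrier])
    then show False using c by simp
  qed
  moreover have "enat_floor_div d (card (P \<inter> Q)) \<le> enat (hamming_weight c)"
    if c: "c \<in> lp_CZ G A B - dual_code (lp_qudits G A B) (lp_CX G A B)" for c
  proof (rule ccontr)
    assume low: "\<not> ?thesis"
    have c0: "c a = 0" if "a \<notin> lp_qudits G A B" for a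
      using c that by (auto simp: lp_CZ_def ker_code_def)
    have supp: "a \<in> lp_qudits G A B" if "c a \<noteq> 0" for a
      using c0 that by blast
    have fc: "finite {a. c a \<noteq> 0}"
      using supp by (auto intro: finite_subset[OF _ finite_lp_qudits[OF finite_carrier]])
    \<comment> \<open>The transpose of \<open>A\<close> acts on the right half, which therefore
      plays the role of \<open>u\<close>. \<open>lp_HZ\<close> carries no minus sign, so the left
      half is negated to obtain the cycle equation.\<close>
    define u where "u = (\<lambda>a. c (Inr a))"
    define v where "v = (\<lambda>a. - c (Inl a))"
    have hw: "hamming_weight u \<le> hamming_weight c" "hamming_weight v \<le> hamming_weight c"
      unfolding u_def v_def hamming_weight_uminus by (rule hamming_weight_comp_le[OF fc], simp)+
    have supp_u: "{a. u a \<noteq> 0} \<subseteq> ({..<dim_row A} \<times> {..<dim_col B}) \<times> carrier G"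
      by (auto simp: u_def dest!: supp[unfolded lp_qudits_def])
    have supp_v: "{a. v a \<noteq> 0} \<subseteq> ({..<dim_col A} \<times> {..<dim_row B}) \<times> carrier G"
      by (auto simp: v_def dest!: supp[unfolded lp_qudits_def])
    have cycle: "(\<Sum>(j, h)\<in>{..<dim_row A} \<times> carrier G. mtx_transpose (left_nat G A) (i, g) (j, h) * u ((j, k), h)) =
      (\<Sum>(l, h)\<in>{..<dim_row B} \<times> carrier G. mtx_transpose (right_nat G B) (k, g) (l, h) * v ((i, l), h))"
      if "i \<in> {..<dim_col A}" "k \<in> {..<dim_col B}" "g \<in> carrier G" for i k g
    proof -
      have "(\<Sum>a\<in>lp_qudits G A B. lp_HZ G A B ((i, k), g) a * c a) = 0"
        using c that by (auto simp: lp_CZ_def ker_code_def lp_Z_checks_def)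
      then show ?thesis
        using lp_HZ_mult[OF finite_carrier, of i A k B g c] that
        by (simp add: u_def v_def mtx_transpose_def sum_negf case_prod_unfold add_eq_0_iff)
    qed
    have "\<exists>w. (\<forall>j\<in>{..<dim_row A}. \<forall>k\<in>{..<dim_col B}. \<forall>g\<in>carrier G.
        u ((j, k), g) = (\<Sum>(l, h)\<in>{..<dim_row B} \<times> carrier G. mtx_transpose (right_nat G B) (k, g) (l, h) * w ((j, l), h))) \<and>
      (\<forall>i\<in>{..<dim_col A}. \<forall>l\<in>{..<dim_row B}. \<forall>g\<in>carrier G.
        v ((i, l), g) = (\<Sum>(j, h)\<in>{..<dim_row A} \<times> carrier G. mtx_transpose (left_nat G A) (i, g) (j, h) * w ((j, l), h)))"
      by (rule low_weight_cycle_is_boundary[OF left_conv_transpose[OF left_conv_left_nat[OF A]]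
          right_conv_transpose[OF right_conv_right_nat[OF B]]
          finite_lessThan finite_lessThan finite_lessThan finite_lessThan Q0 supp_u supp_v cycle
          trivial[OF low d(3) _ _ hw(1), unfolded left_code_transp_subgroup]
          trivial[OF low d(4) _ _ hw(2), unfolded right_code_transp_subgroup]])
    then obtain w where w:
      "\<And>j k g. j < dim_row A \<Longrightarrow> k < dim_col B \<Longrightarrow> g \<in> carrier G \<Longrightarrow>
        c (Inr ((j, k), g)) = (\<Sum>(l, h)\<in>{..<dim_row B} \<times> carrier G. mtx_transpose (right_nat G B) (k, g) (l, h) * w ((j, l), h))"
      "\<And>i l g. i < dim_col A \<Longrightarrow> l < dim_row B \<Longrightarrow> g \<in> carrier G \<Longrightarrow>
        - c (Inl ((i, l), g)) = (\<Sum>(j, h)\<in>{..<dim_row A} \<times> carrier G. mtx_transpose (left_nat G A) (i, g) (j, h) * w ((j, l), h))"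
      unfolding u_def v_def by blast
    have "c (Inl ((i, l), g)) =
        - (\<Sum>(j, h)\<in>{..<dim_row A} \<times> carrier G. mtx_transpose (left_nat G A) (i, g) (j, h) * w ((j, l), h))"
      if "i < dim_col A" "l < dim_row B" "g \<in> carrier G" for i l g
      using w(2)[OF that] by (metis minus_minus)
    \<comment> \<open>The coefficients are \<open>- w\<close>: the minus sign of
      \<open>lp_HX\<close> sits on the right half, and the left half was negated above.\<close>
    with w(1) have "c \<in> dual_code (lp_qudits G A B) (lp_CX G A B)"
      unfolding lp_CX_def
      by (intro row_combination_in_dual_code[where w = "\<lambda>r. - w r"] finite_lp_qudits[OF finite_carrier] c0)
        (auto simp: lp_qudits_def lp_HX_transpose_mult_Inl[OF finite_carrier]
          lp_HX_transpose_mult_Inr[OF finite_carrier] mtx_transpose_def sum_negf case_prod_unfold)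
    then show False using c by simp
  qed
  ultimately show ?thesis
    unfolding lp_distance_def css_distance_def min_weight_def
    by (auto intro!: INF_greatest)
qed

end

section \<open>The dihedral group\<close>

theorem theorem3p8:
  fixes n m\<^sub>A m\<^sub>B :: nat
    and G\<^sub>A G\<^sub>B :: "(int \<times> bool) set"
    and A B :: "(int \<times> bool \<Rightarrow> 'f::{field,finite}) mat"
  assumes "n \<ge> 2"
    and "\<not> CHAR('f) dvd 2 * n"
    and "subgroup G\<^sub>A (dihedral n)" and "G\<^sub>A \<noteq> carrier (dihedral n)"
    and "subgroup G\<^sub>B (dihedral n)" and "G\<^sub>B \<noteq> carrier (dihedral n)"
    and "comm_group (dihedral n\<lparr>carrier := G\<^sub>A \<inter> G\<^sub>B\<rparr>)"
    and "G\<^sub>A \<inter> G\<^sub>B \<lhd> dihedral n\<lparr>carrier := G\<^sub>A\<rparr>"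
    and "G\<^sub>A \<inter> G\<^sub>B \<lhd> dihedral n\<lparr>carrier := G\<^sub>B\<rparr>"
    and "card (rcosets\<^bsub>dihedral n\<lparr>carrier := G\<^sub>A\<rparr>\<^esub> (G\<^sub>A \<inter> G\<^sub>B))
         * card (rcosets\<^bsub>dihedral n\<lparr>carrier := G\<^sub>B\<rparr>\<^esub> (G\<^sub>A \<inter> G\<^sub>B))
         * card (G\<^sub>A \<inter> G\<^sub>B) = 2 * n"
    and "A \<in> carrier_mat m\<^sub>A m\<^sub>A" and "elements_mat A \<subseteq> group_algebra G\<^sub>A"
    and "B \<in> carrier_mat m\<^sub>B m\<^sub>B" and "elements_mat B \<subseteq> group_algebra G\<^sub>B"
  defines "d\<^sub>0 \<equiv> Min {min_distance (left_code (dihedral n\<lparr>carrier := G\<^sub>A\<rparr>) A),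
                    min_distance (right_code (dihedral n\<lparr>carrier := G\<^sub>B\<rparr>) B),
                    min_distance (left_code_transp (dihedral n\<lparr>carrier := G\<^sub>A\<rparr>) A),
                    min_distance (right_code_transp (dihedral n\<lparr>carrier := G\<^sub>B\<rparr>) B)}"
  shows "lp_distance (dihedral n) A B \<ge> enat_floor_div d\<^sub>0 (card (G\<^sub>A \<inter> G\<^sub>B))"
proof -
  let ?G = "dihedral n" and ?N = "G\<^sub>A \<inter> G\<^sub>B"
  interpret group ?G using \<open>n \<ge> 2\<close> by (intro group_dihedral) simp
  have fin: "finite (carrier ?G)" by (simp add: dihedral_def)
  define a b where "a = card (rcosets\<^bsub>?G\<lparr>carrier := G\<^sub>A\<rparr>\<^esub> ?N)"
    and "b = card (rcosets\<^bsub>?G\<lparr>carrier := G\<^sub>B\<rparr>\<^esub> ?N)"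
  \<comment> \<open>Lagrange's theorem in each factor. Multiplying the index condition by |N| then
    gives |G_A| |G_B| = 2n |N|, the equality from which G_A G_B is the whole group.\<close>
  have "a * card ?N = card G\<^sub>A"
    using group.lagrange[OF subgroup.subgroup_is_group[OF assms(3) is_group]
        normal.axioms(1)[OF assms(8)]] by (simp add: order_def a_def)
  moreover have "b * card ?N = card G\<^sub>B"
    using group.lagrange[OF subgroup.subgroup_is_group[OF assms(5) is_group]
        normal.axioms(1)[OF assms(9)]] by (simp add: order_def b_def)
  moreover have "(a * card ?N) * (b * card ?N) = (a * b * card ?N) * card ?N"
    by (simp only: ac_simps)
  ultimately have "card G\<^sub>A * card G\<^sub>B = order ?G * card ?N"
    using assms(10) by (simp only: a_def b_def order_dihedral)
  then have fac: "G\<^sub>A <#>\<^bsub>?G\<^esub> G\<^sub>B = carrier ?G"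
    by (intro set_mult_eq_carrier assms(3,5) fin)
  interpret factorised_group ?G G\<^sub>A G\<^sub>B
    by (intro factorised_group.intro factorised_group_axioms.intro is_group fin assms(3,5) fac)
  \<comment> \<open>A characteristic that does not divide 2n cannot divide its divisor |G_B|, so
    Maschke averaging over G_B is available.\<close>
  have "card G\<^sub>B dvd 2 * n"
    using lagrange[OF assms(5)] by (metis dvd_triv_right order_dihedral)
  then have "of_nat (card G\<^sub>B) \<noteq> (0 :: 'f)"
    using assms(2) by (metis dvd_trans of_nat_eq_0_iff_char_dvd)
  then show ?thesis
    unfolding d\<^sub>0_def using assms(12,14) by (intro lp_distance_ge Min_le) auto
qed

end
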